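(* Let $(R,\mathfrak m)$ be a one-dimensional Noetherian Cohen-Macaulay local ring possessing a canonical module $\omega_R$, with total ring of fractions $Q(R)$ and integral closure $\overline R$ of $R$ in $Q(R)$. Suppose that: (a) there is an $R$-submodule $C$ of $Q(R)$ with $R\subseteq C\subseteq\overline R$ and $C\cong\omega_R$; (b) $\overline R$ is finitely generated as an $R$-module; (c) $\overline R$ is a local ring. Fix $C$ as in (a). Then the following are equivalent: (i) $R$ is a far-flung Gorenstein ring, i.e. $\mathrm{tr}_R(\omega_R)=R:\overline R$; (ii) $\mathrm{tr}_R(\omega_R)\cong\overline R$ (as $R$-modules); (iii) $C^2=\overline R$.
   Context: For a finitely generated $R$-module $M$, the trace ideal is $\mathrm{tr}_R(M)=\sum_{f\in\mathrm{Hom}_R(M,R)}\mathrm{Im}\,f\subseteq R$. A fractional ideal is a finitely generated $R$-submodule of $Q(R)$ containing a non-zerodivisor of $R$; for fractional ideals $I,J$, $I:J=\{\alpha\in Q(R): \alpha J\subseteq I\}$. $C^2=C\cdot C$ is the $R$-submodule of $Q(R)$ generated by all products of two elements of $C$. A one-dimensional Cohen-Macaulay local ring $R$ with canonical module satisfying (a) and (b) is called far-flung Gorenstein if $\mathrm{tr}_R(\omega_R)=R:\overline R$. *)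

theory Defs
  imports "HOL-Algebra.Algebra" "HOL-Library.Extended_Nat"
begin

section \<open>Local rings, dimension, depth\<close>

definition local_ring :: "('a, 'm) ring_scheme \<Rightarrow> bool" where
  "local_ring R \<longleftrightarrow> cring R \<and> (\<exists>!I. maximalideal I R)"

definition max_ideal :: "('a, 'm) ring_scheme \<Rightarrow> 'a set" where
  "max_ideal R = (THE I. maximalideal I R)"

definition krull_dim :: "('a, 'm) ring_scheme \<Rightarrow> enat" where
  "krull_dim R = Sup {enat n |n. \<exists>P :: nat \<Rightarrow> 'a set.
     (\<forall>i\<le>n. primeideal (P i) R) \<and> (\<forall>i<n. P i \<subset> P (Suc i))}"

text \<open>A list \<open>xs\<close> is a regular sequence if each \<open>xs ! i\<close> is a non-zerodivisor modulo the ideal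
  generated by its predecessors and \<open>xs\<close> generates a proper ideal.\<close>

definition regular_sequence :: "('a, 'm) ring_scheme \<Rightarrow> 'a list \<Rightarrow> bool" where
  "regular_sequence R xs \<longleftrightarrow>
     set xs \<subseteq> carrier R \<and>
     (\<forall>i<length xs. \<forall>a\<in>carrier R.
        xs ! i \<otimes>\<^bsub>R\<^esub> a \<in> Idl\<^bsub>R\<^esub> (set (take i xs)) \<longrightarrow> a \<in> Idl\<^bsub>R\<^esub> (set (take i xs))) \<and>
     Idl\<^bsub>R\<^esub> (set xs) \<noteq> carrier R"

definition depth :: "('a, 'm) ring_scheme \<Rightarrow> enat" where
  "depth R = Sup {enat (length xs) |xs. regular_sequence R xs \<and> set xs \<subseteq> max_ideal R}"

definition cohen_macaulay_local_ring :: "('a, 'm) ring_scheme \<Rightarrow> bool" where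
  "cohen_macaulay_local_ring R \<longleftrightarrow>
     noetherian_ring R \<and> local_ring R \<and> depth R = krull_dim R"


section \<open>Modules\<close>

text \<open>The type \<^typ>\<open>('a, 'b) module\<close> extends the record of rings, so each construction below has to
  fill the fields \<open>mult\<close> and \<open>one\<close>; they play no role for modules.\<close>

definition module_hom ::
  "('a, 'm) ring_scheme \<Rightarrow> ('a, 'b, 'p) module_scheme \<Rightarrow> ('a, 'c, 'q) module_scheme \<Rightarrow> ('b \<Rightarrow> 'c) set"
  where
  "module_hom R M N = {f \<in> carrier M \<rightarrow> carrier N.
     (\<forall>x\<in>carrier M. \<forall>y\<in>carrier M. f (x \<oplus>\<^bsub>M\<^esub> y) = f x \<oplus>\<^bsub>N\<^esub> f y) \<and>
     (\<forall>a\<in>carrier R. \<forall>x\<in>carrier M. f (a \<odot>\<^bsub>M\<^esub> x) = a \<odot>\<^bsub>N\<^esub> f x)}"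

definition module_isomorphic ::
  "('a, 'm) ring_scheme \<Rightarrow> ('a, 'b, 'p) module_scheme \<Rightarrow> ('a, 'c, 'q) module_scheme \<Rightarrow> bool" where
  "module_isomorphic R M N \<longleftrightarrow> (\<exists>f \<in> module_hom R M N. bij_betw f (carrier M) (carrier N))"

definition module_span ::
  "('a, 'm) ring_scheme \<Rightarrow> ('a, 'b, 'p) module_scheme \<Rightarrow> 'b set \<Rightarrow> 'b set" where
  "module_span R M S = \<Inter>{N. submodule N R M \<and> S \<subseteq> N}"

definition finitely_generated_module ::
  "('a, 'm) ring_scheme \<Rightarrow> ('a, 'b, 'p) module_scheme \<Rightarrow> bool" where
  "finitely_generated_module R M \<longleftrightarrow>
     (\<exists>S. finite S \<and> S \<subseteq> carrier M \<and> module_span R M S = carrier M)"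

text \<open>A subset \<open>S\<close> of a ring \<open>A\<close>, with scalars acting by the multiplication of \<open>A\<close>. It is used
  for \<open>S\<close> an \<open>R\<close>-submodule of \<open>A\<close>, where \<open>R\<close> is a subring of \<open>A\<close>.\<close>

definition sub_module_of_ring :: "('a, 'm) ring_scheme \<Rightarrow> 'a set \<Rightarrow> ('a, 'a) module" where
  "sub_module_of_ring A S =
     \<lparr>carrier = S, monoid.mult = (\<otimes>\<^bsub>A\<^esub>), monoid.one = \<one>\<^bsub>A\<^esub>,
      ring.zero = \<zero>\<^bsub>A\<^esub>, ring.add = (\<oplus>\<^bsub>A\<^esub>), smult = (\<otimes>\<^bsub>A\<^esub>)\<rparr>"

definition quotient_module :: "('a, 'b, 'p) module_scheme \<Rightarrow> 'b set \<Rightarrow> ('a, 'b set) module" where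
  "quotient_module M N =
     \<lparr>carrier = a_rcosets\<^bsub>M\<^esub> N, monoid.mult = (\<lambda>_ _. undefined), monoid.one = undefined,
      ring.zero = N, ring.add = (<+>\<^bsub>M\<^esub>), smult = (\<lambda>a U. \<Union>x\<in>U. N +>\<^bsub>M\<^esub> (a \<odot>\<^bsub>M\<^esub> x))\<rparr>"

text \<open>A set \<open>H\<close> of functions from \<open>D\<close> to \<open>N\<close>, extensional on \<open>D\<close>, with pointwise operations.\<close>

definition function_module ::
  "'x set \<Rightarrow> ('a, 'b, 'p) module_scheme \<Rightarrow> ('x \<Rightarrow> 'b) set \<Rightarrow> ('a, 'x \<Rightarrow> 'b) module" where
  "function_module D N H =
     \<lparr>carrier = H, monoid.mult = (\<lambda>_ _. undefined), monoid.one = undefined,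
      ring.zero = (\<lambda>x\<in>D. \<zero>\<^bsub>N\<^esub>), ring.add = (\<lambda>f g. \<lambda>x\<in>D. f x \<oplus>\<^bsub>N\<^esub> g x),
      smult = (\<lambda>a f. \<lambda>x\<in>D. a \<odot>\<^bsub>N\<^esub> f x)\<rparr>"

definition hom_module ::
  "('a, 'm) ring_scheme \<Rightarrow> ('a, 'b, 'p) module_scheme \<Rightarrow> ('a, 'c, 'q) module_scheme \<Rightarrow>
   ('a, 'b \<Rightarrow> 'c) module" where
  "hom_module R M N =
     function_module (carrier M) N (module_hom R M N \<inter> extensional (carrier M))"

definition free_module :: "('a, 'm) ring_scheme \<Rightarrow> nat \<Rightarrow> ('a, nat \<Rightarrow> 'a) module" where
  "free_module R n =
     function_module {..<n} (sub_module_of_ring R (carrier R)) ({..<n} \<rightarrow>\<^sub>E carrier R)"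


section \<open>Ext and canonical modules\<close>

text \<open>\<open>\<cdots> \<rightarrow> R\<^bsup>b 2\<^esup> \<rightarrow> R\<^bsup>b 1\<^esup> \<rightarrow> R\<^bsup>b 0\<^esup> \<rightarrow> M \<rightarrow> 0\<close> is exact, with differentials
  \<open>d i : R\<^bsup>b (i + 1)\<^esup> \<rightarrow> R\<^bsup>b i\<^esup>\<close> and augmentation \<open>e\<close>. Over a Noetherian ring every finitely
  generated module has such a resolution.\<close>

definition free_resolution ::
  "('a, 'm) ring_scheme \<Rightarrow> ('a, 'b, 'p) module_scheme \<Rightarrow> (nat \<Rightarrow> nat) \<Rightarrow>
   ((nat \<Rightarrow> 'a) \<Rightarrow> 'b) \<Rightarrow> (nat \<Rightarrow> (nat \<Rightarrow> 'a) \<Rightarrow> (nat \<Rightarrow> 'a)) \<Rightarrow> bool" where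
  "free_resolution R M b e d \<longleftrightarrow>
     (let F = (\<lambda>i. free_module R (b i)) in
       e \<in> module_hom R (F 0) M \<and>
       (\<forall>i. d i \<in> module_hom R (F (Suc i)) (F i)) \<and>
       e ` carrier (F 0) = carrier M \<and>
       d 0 ` carrier (F (Suc 0)) = a_kernel (F 0) M e \<and>
       (\<forall>i. d (Suc i) ` carrier (F (Suc (Suc i))) = a_kernel (F (Suc i)) (F i) (d i)))"

text \<open>Cocycles and coboundaries of the complex \<open>Hom(R\<^bsup>b 0\<^esup>, N) \<rightarrow> Hom(R\<^bsup>b 1\<^esup>, N) \<rightarrow> \<cdots>\<close>.\<close>

definition ext_cocycles ::
  "('a, 'm) ring_scheme \<Rightarrow> ('a, 'c, 'q) module_scheme \<Rightarrow> (nat \<Rightarrow> nat) \<Rightarrow>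
   (nat \<Rightarrow> (nat \<Rightarrow> 'a) \<Rightarrow> (nat \<Rightarrow> 'a)) \<Rightarrow> nat \<Rightarrow> ((nat \<Rightarrow> 'a) \<Rightarrow> 'c) set" where
  "ext_cocycles R N b d i =
     {f \<in> carrier (hom_module R (free_module R (b i)) N).
        \<forall>x \<in> carrier (free_module R (b (Suc i))). f (d i x) = \<zero>\<^bsub>N\<^esub>}"

fun ext_coboundaries ::
  "('a, 'm) ring_scheme \<Rightarrow> ('a, 'c, 'q) module_scheme \<Rightarrow> (nat \<Rightarrow> nat) \<Rightarrow>
   (nat \<Rightarrow> (nat \<Rightarrow> 'a) \<Rightarrow> (nat \<Rightarrow> 'a)) \<Rightarrow> nat \<Rightarrow> ((nat \<Rightarrow> 'a) \<Rightarrow> 'c) set" where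
  "ext_coboundaries R N b d 0 = {\<zero>\<^bsub>hom_module R (free_module R (b 0)) N\<^esub>}"
| "ext_coboundaries R N b d (Suc i) =
     (\<lambda>g. compose (carrier (free_module R (b (Suc i)))) g (d i)) `
       carrier (hom_module R (free_module R (b i)) N)"

definition ext_of_resolution ::
  "('a, 'm) ring_scheme \<Rightarrow> ('a, 'c, 'q) module_scheme \<Rightarrow> (nat \<Rightarrow> nat) \<Rightarrow>
   (nat \<Rightarrow> (nat \<Rightarrow> 'a) \<Rightarrow> (nat \<Rightarrow> 'a)) \<Rightarrow> nat \<Rightarrow> ('a, ((nat \<Rightarrow> 'a) \<Rightarrow> 'c) set) module" where
  "ext_of_resolution R N b d i =
     quotient_module
       ((hom_module R (free_module R (b i)) N)\<lparr>carrier := ext_cocycles R N b d i\<rparr>)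
       (ext_coboundaries R N b d i)"

text \<open>\<open>ext_isomorphic R i M N E\<close> says \<open>Ext\<^bsup>i\<^esup>\<^bsub>R\<^esub>(M, N) \<cong> E\<close>, for \<open>M\<close> finitely generated over a
  Noetherian ring \<open>R\<close>; Ext does not depend, up to isomorphism, on the resolution.\<close>

definition ext_isomorphic ::
  "('a, 'm) ring_scheme \<Rightarrow> nat \<Rightarrow> ('a, 'b, 'p) module_scheme \<Rightarrow> ('a, 'c, 'q) module_scheme \<Rightarrow>
   ('a, 'e, 'r) module_scheme \<Rightarrow> bool" where
  "ext_isomorphic R i M N E \<longleftrightarrow>
     (\<exists>b e d. free_resolution R M b e d \<and> module_isomorphic R (ext_of_resolution R N b d i) E)"

definition residue_field_module :: "('a, 'm) ring_scheme \<Rightarrow> ('a, 'a set) module" where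
  "residue_field_module R =
     quotient_module (sub_module_of_ring R (carrier R)) (max_ideal R)"

definition zero_module :: "('a, 'm) ring_scheme \<Rightarrow> ('a, 'a) module" where
  "zero_module R = sub_module_of_ring R {\<zero>\<^bsub>R\<^esub>}"

text \<open>For a Cohen--Macaulay local ring \<open>R\<close> of dimension \<open>d\<close> with residue field \<open>k\<close>, a canonical
  module is a finitely generated \<open>R\<close>-module \<open>W\<close> with \<open>Ext\<^bsup>d\<^esup>(k, W) \<cong> k\<close> and \<open>Ext\<^bsup>i\<^esup>(k, W) = 0\<close> for
  \<open>i \<noteq> d\<close>: vanishing below \<open>d\<close> says that \<open>W\<close> is maximal Cohen--Macaulay, vanishing above \<open>d\<close> that its
  injective dimension is finite, and the condition in degree \<open>d\<close> that its type is \<open>1\<close>.\<close>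

definition canonical_module ::
  "('a, 'm) ring_scheme \<Rightarrow> ('a, 'w, 'p) module_scheme \<Rightarrow> bool" where
  "canonical_module R W \<longleftrightarrow>
     cohen_macaulay_local_ring R \<and> module R W \<and> finitely_generated_module R W \<and>
     (\<forall>i. if enat i = krull_dim R
          then ext_isomorphic R i (residue_field_module R) W (residue_field_module R)
          else ext_isomorphic R i (residue_field_module R) W (zero_module R))"

text \<open>The sum of the images of all homomorphisms \<open>M \<rightarrow> R\<close>, i.e. the ideal generated by them.\<close>

definition trace_ideal ::
  "('a, 'm) ring_scheme \<Rightarrow> ('a, 'b, 'p) module_scheme \<Rightarrow> 'a set" where
  "trace_ideal R M =
     Idl\<^bsub>R\<^esub> (\<Union>f \<in> module_hom R M (sub_module_of_ring R (carrier R)). f ` carrier M)"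


section \<open>Total ring of fractions and fractional ideals\<close>

definition non_zerodivisors :: "('a, 'm) ring_scheme \<Rightarrow> 'a set" where
  "non_zerodivisors R = {s \<in> carrier R. \<forall>a\<in>carrier R. s \<otimes>\<^bsub>R\<^esub> a = \<zero>\<^bsub>R\<^esub> \<longrightarrow> a = \<zero>\<^bsub>R\<^esub>}"

text \<open>\<open>Q\<close> is the localization of \<open>R\<close> at its non-zerodivisors, with \<open>R\<close> identified with its image in
  \<open>Q\<close>: the canonical map is injective, and here it is the inclusion.\<close>

definition total_ring_of_fractions :: "('a, 'm) ring_scheme \<Rightarrow> ('a, 'n) ring_scheme \<Rightarrow> bool" where
  "total_ring_of_fractions R Q \<longleftrightarrow>
     cring R \<and> cring Q \<and> (\<lambda>x. x) \<in> ring_hom R Q \<and>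
     non_zerodivisors R \<subseteq> Units Q \<and>
     carrier Q = {a \<otimes>\<^bsub>Q\<^esub> inv\<^bsub>Q\<^esub> s |a s. a \<in> carrier R \<and> s \<in> non_zerodivisors R}"

text \<open>The list \<open>p\<close> contains the coefficients of a monic polynomial, leading coefficient first.\<close>

definition integral_closure :: "('a, 'm) ring_scheme \<Rightarrow> ('a, 'n) ring_scheme \<Rightarrow> 'a set" where
  "integral_closure R Q = {x \<in> carrier Q.
     \<exists>p. p \<noteq> [] \<and> set p \<subseteq> carrier R \<and> hd p = \<one>\<^bsub>R\<^esub> \<and> ring.eval Q p x = \<zero>\<^bsub>Q\<^esub>}"

text \<open>The colon \<open>I : J\<close> in \<open>Q\<close>.\<close>

definition colon :: "('a, 'n) ring_scheme \<Rightarrow> 'a set \<Rightarrow> 'a set \<Rightarrow> 'a set" where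
  "colon Q I J = {x \<in> carrier Q. \<forall>y\<in>J. x \<otimes>\<^bsub>Q\<^esub> y \<in> I}"

definition module_product ::
  "('a, 'm) ring_scheme \<Rightarrow> ('a, 'n) ring_scheme \<Rightarrow> 'a set \<Rightarrow> 'a set \<Rightarrow> 'a set" where
  "module_product R Q I J =
     module_span R (sub_module_of_ring Q (carrier Q)) {x \<otimes>\<^bsub>Q\<^esub> y |x y. x \<in> I \<and> y \<in> J}"

definition canonical_submodule ::
  "('a, 'm) ring_scheme \<Rightarrow> ('a, 'n) ring_scheme \<Rightarrow> ('a, 'w, 'p) module_scheme \<Rightarrow> 'a set \<Rightarrow> bool"
  where
  "canonical_submodule R Q W C \<longleftrightarrow>
     submodule C R (sub_module_of_ring Q (carrier Q)) \<and>
     carrier R \<subseteq> C \<and> C \<subseteq> integral_closure R Q \<and>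
     module_isomorphic R (sub_module_of_ring Q C) W"

definition far_flung_gorenstein ::
  "('a, 'm) ring_scheme \<Rightarrow> ('a, 'n) ring_scheme \<Rightarrow> ('a, 'w, 'p) module_scheme \<Rightarrow> bool" where
  "far_flung_gorenstein R Q W \<longleftrightarrow>
     cohen_macaulay_local_ring R \<and> krull_dim R = 1 \<and>
     total_ring_of_fractions R Q \<and> canonical_module R W \<and>
     (\<exists>C. canonical_submodule R Q W C) \<and>
     finitely_generated_module R (sub_module_of_ring Q (integral_closure R Q)) \<and>
     trace_ideal R W = colon Q (carrier R) (integral_closure R Q)"

end

(*
The only property of the canonical module that matters is that (C : m)/C has length one; it is
extracted from Ext^1(k, C) = k. It implies that I = C : (C : I) for every fractional ideal I: the
property passes from I to I + R y whenever m y is contained in I, and it holds for I = x C.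
In particular C : C = R, hence R : C = C : C^2 and tr(C) = (R : C) C.

If C^2 is the integral closure S, this gives R : C = C : S = R : S, so tr(C) = R : S. Conversely,
if tr(C) is closed under multiplication by S, then so are R : C = C : C^2 and its dual C^2, which
contains 1, so C^2 = S; both R : S and any R-module isomorphic to S are closed in this way.
Finally R : S is isomorphic to S, because S turns out to be a discrete valuation ring.
*)

theory Submission
  imports Defs
begin

section \<open>Modules and Ext\<close>

text \<open>The definition of Ext allows any free resolution of k, so no convenient one can be
  chosen; lifting its augmentation to R is what connects it with maps m -> C. An element z of C : m
  gives the map p -> z p, which is of the form p -> p w with w in C only if z lies in C.

  Duality climbs from x C to a fractional ideal I in socle steps. Such a step exists because, in
  dimension one, a prime containing a nonzerodivisor is m: a nonzero quotient of two fractional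
  ideals is killed by a nonzerodivisor, and a maximal annihilator of its elements is prime, hence
  equal to m. No lengths are formed. Termination comes from maximal members of families of
  submodules, which a unit of Q(R) moves into R, where the Noetherian property applies. Finite
  generation of S supplies the denominator s with s S inside R that makes these moves possible.

  That S is local enters through a Nakayama argument for S-submodules of R : S. Duality then
  provides an element x outside S, and the fact that S is completely integrally closed controls its
  powers.\<close>

lemma sub_module_simps:
  "carrier (sub_module_of_ring S V) = V" "\<zero>\<^bsub>sub_module_of_ring S V\<^esub> = \<zero>\<^bsub>S\<^esub>"
  "x \<oplus>\<^bsub>sub_module_of_ring S V\<^esub> y = x \<oplus>\<^bsub>S\<^esub> y"
  "x \<odot>\<^bsub>sub_module_of_ring S V\<^esub> y = x \<otimes>\<^bsub>S\<^esub> y"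
  by (simp_all add: sub_module_of_ring_def)

lemma module_homD:
  assumes "f \<in> module_hom R M N"
  shows "x \<in> carrier M \<Longrightarrow> f x \<in> carrier N"
    "x \<in> carrier M \<Longrightarrow> y \<in> carrier M \<Longrightarrow> f (x \<oplus>\<^bsub>M\<^esub> y) = f x \<oplus>\<^bsub>N\<^esub> f y"
    "a \<in> carrier R \<Longrightarrow> x \<in> carrier M \<Longrightarrow> f (a \<odot>\<^bsub>M\<^esub> x) = a \<odot>\<^bsub>N\<^esub> f x"
  using assms by (auto simp: module_hom_def)

lemma module_homI:
  assumes "\<And>x. x \<in> carrier M \<Longrightarrow> f x \<in> carrier N"
    "\<And>x y. x \<in> carrier M \<Longrightarrow> y \<in> carrier M \<Longrightarrow> f (x \<oplus>\<^bsub>M\<^esub> y) = f x \<oplus>\<^bsub>N\<^esub> f y"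
    "\<And>a x. a \<in> carrier R \<Longrightarrow> x \<in> carrier M \<Longrightarrow> f (a \<odot>\<^bsub>M\<^esub> x) = a \<odot>\<^bsub>N\<^esub> f x"
  shows "f \<in> module_hom R M N"
  using assms by (auto simp: module_hom_def)

lemma module_hom_zero:
  assumes "f \<in> module_hom R M N" "module R M" "module R N"
  shows "f \<zero>\<^bsub>M\<^esub> = \<zero>\<^bsub>N\<^esub>"
proof -
  interpret M: module R M by fact
  interpret N: module R N by fact
  have "f (\<zero>\<^bsub>R\<^esub> \<odot>\<^bsub>M\<^esub> \<zero>\<^bsub>M\<^esub>) = \<zero>\<^bsub>R\<^esub> \<odot>\<^bsub>N\<^esub> f \<zero>\<^bsub>M\<^esub>"
    using module_homD(3)[OF assms(1), of "\<zero>\<^bsub>R\<^esub>" "\<zero>\<^bsub>M\<^esub>"] by simp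
  then show ?thesis using module_homD(1)[OF assms(1)] by simp
qed

lemma module_hom_comp:
  "f \<in> module_hom R M N \<Longrightarrow> g \<in> module_hom R N P \<Longrightarrow> (\<lambda>x. g (f x)) \<in> module_hom R M P"
  by (intro module_homI) (simp_all add: module_homD)

lemma module_iso_sym:
  assumes "module R M" "f \<in> module_hom R M N" "bij_betw f (carrier M) (carrier N)"
  shows "inv_into (carrier M) f \<in> module_hom R N M"
proof -
  interpret M: module R M by fact
  note fD = module_homD[OF assms(2)]
  let ?g = "inv_into (carrier M) f"
  have g: "?g y \<in> carrier M" "f (?g y) = y" if "y \<in> carrier N" for y
    using that assms(3) by (auto simp: bij_betw_def inv_into_into f_inv_into_f)
  have gf: "?g (f x) = x" if "x \<in> carrier M" for x
    using that assms(3) by (simp add: bij_betw_def)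
  show ?thesis
  proof (rule module_homI)
    show "?g y \<in> carrier M" if "y \<in> carrier N" for y using g that by blast
    show "?g (x \<oplus>\<^bsub>N\<^esub> y) = ?g x \<oplus>\<^bsub>M\<^esub> ?g y" if "x \<in> carrier N" "y \<in> carrier N" for x y
      using gf[of "?g x \<oplus>\<^bsub>M\<^esub> ?g y"] fD(2) g that by simp
    show "?g (a \<odot>\<^bsub>N\<^esub> x) = a \<odot>\<^bsub>M\<^esub> ?g x" if "a \<in> carrier R" "x \<in> carrier N" for a x
      using gf[of "a \<odot>\<^bsub>M\<^esub> ?g x"] fD(3) g that by simp
  qed
qed

lemma submodule_scalarI:
  assumes "module R M" "H \<subseteq> carrier M" "\<zero>\<^bsub>M\<^esub> \<in> H"
    "\<And>x y. x \<in> H \<Longrightarrow> y \<in> H \<Longrightarrow> x \<oplus>\<^bsub>M\<^esub> y \<in> H"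
    "\<And>a x. a \<in> carrier R \<Longrightarrow> x \<in> H \<Longrightarrow> a \<odot>\<^bsub>M\<^esub> x \<in> H"
  shows "submodule H R M"
proof -
  interpret M: module R M by fact
  show ?thesis
  proof (rule M.submoduleI)
    fix x assume x: "x \<in> H"
    then have "\<ominus>\<^bsub>M\<^esub> x = (\<ominus>\<^bsub>R\<^esub> \<one>\<^bsub>R\<^esub>) \<odot>\<^bsub>M\<^esub> x"
      using assms(2) by (simp add: M.smult_l_minus subset_iff)
    then show "\<ominus>\<^bsub>M\<^esub> x \<in> H" using assms(5) x by simp
  qed (use assms in auto)
qed

text \<open>Stated for an arbitrary set \<open>H\<close> of extensional functions, so that it covers
  both the free modules and the modules of cocycles.\<close>

lemma function_module_module:
  assumes "module R N" and H: "H \<subseteq> D \<rightarrow>\<^sub>E carrier N" and zero: "(\<lambda>x\<in>D. \<zero>\<^bsub>N\<^esub>) \<in> H"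
    and add: "\<And>f g. f \<in> H \<Longrightarrow> g \<in> H \<Longrightarrow> (\<lambda>x\<in>D. f x \<oplus>\<^bsub>N\<^esub> g x) \<in> H"
    and smult: "\<And>a f. a \<in> carrier R \<Longrightarrow> f \<in> H \<Longrightarrow> (\<lambda>x\<in>D. a \<odot>\<^bsub>N\<^esub> f x) \<in> H"
  shows "module R (function_module D N H)"
proof -
  interpret N: module R N by fact
  have c: "f x \<in> carrier N" if "f \<in> H" "x \<in> D" for f x using H that by blast
  have ext: "f = (\<lambda>x\<in>D. f x)" if "f \<in> H" for f
    using H that by (metis PiE_restrict subsetD)
  have eqI: "(\<lambda>x\<in>D. f x) = (\<lambda>x\<in>D. g x)" if "\<And>x. x \<in> D \<Longrightarrow> f x = g x" for f g
    using that by (auto simp: restrict_def)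
  have eqI': "(\<lambda>x\<in>D. f x) = g" if "g \<in> H" "\<And>x. x \<in> D \<Longrightarrow> f x = g x" for f g
    using that ext by (metis restrict_ext)
  show ?thesis
  proof (rule moduleI)
    show "cring R" by (rule N.R.cring_axioms)
    show "abelian_group (function_module D N H)"
    proof (rule abelian_groupI)
      fix f assume "f \<in> carrier (function_module D N H)"
      then have f: "f \<in> H" by (simp add: function_module_def)
      have "(\<lambda>x\<in>D. (\<ominus>\<^bsub>R\<^esub> \<one>\<^bsub>R\<^esub>) \<odot>\<^bsub>N\<^esub> f x) \<in> H" using smult f by simp
      moreover have "(\<lambda>x\<in>D. (\<lambda>x\<in>D. (\<ominus>\<^bsub>R\<^esub> \<one>\<^bsub>R\<^esub>) \<odot>\<^bsub>N\<^esub> f x) x \<oplus>\<^bsub>N\<^esub> f x) = (\<lambda>x\<in>D. \<zero>\<^bsub>N\<^esub>)"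
        using c[OF f] by (intro eqI) (simp add: N.smult_l_minus N.M.l_neg)
      ultimately show "\<exists>g\<in>carrier (function_module D N H).
          g \<oplus>\<^bsub>function_module D N H\<^esub> f = \<zero>\<^bsub>function_module D N H\<^esub>"
        by (intro bexI[of _ "\<lambda>x\<in>D. (\<ominus>\<^bsub>R\<^esub> \<one>\<^bsub>R\<^esub>) \<odot>\<^bsub>N\<^esub> f x"])
          (simp_all only: function_module_def module.simps ring.simps partial_object.simps)
    qed (use zero add c in \<open>auto simp: function_module_def N.M.a_ac intro!: eqI eqI'\<close>)
  qed (use smult c in \<open>auto simp: function_module_def N.smult_l_distr N.smult_r_distr
        N.smult_assoc1 intro!: eqI eqI'\<close>)
qed

lemma ring_module:
  assumes "cring R"
  shows "module R (sub_module_of_ring R (carrier R))"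
proof -
  interpret cring R by fact
  have "abelian_group (sub_module_of_ring R (carrier R))"
    by (rule abelian_groupI) (use a_assoc a_comm in \<open>auto simp: sub_module_of_ring_def\<close>)
  then show ?thesis
    by (intro moduleI) (use assms in \<open>auto simp: sub_module_of_ring_def l_distr r_distr m_assoc\<close>)
qed

lemma free_module_module:
  assumes "cring R"
  shows "module R (free_module R n)"
proof -
  interpret cring R by fact
  show ?thesis
    unfolding free_module_def
    by (rule function_module_module[OF ring_module[OF assms]])
      (auto simp: sub_module_of_ring_def PiE_def Pi_def)
qed

lemma quotient_module:
  assumes "module R M" "submodule N R M"
  defines "\<pi> \<equiv> a_r_coset M N"
  shows quotient_module_module: "module R (quotient_module M N)"
    and quotient_map_hom: "\<pi> \<in> module_hom R M (quotient_module M N)"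
    and quotient_map_surj: "\<pi> ` carrier M = carrier (quotient_module M N)"
    and quotient_map_eq_zero: "\<And>x. x \<in> carrier M \<Longrightarrow> \<pi> x = \<zero>\<^bsub>quotient_module M N\<^esub> \<longleftrightarrow> x \<in> N"
proof -
  interpret M: module R M by fact
  have sub: "subgroup N (add_monoid M)" using assms(2) by (rule submodule.axioms(1))
  interpret N: abelian_subgroup N M
    by (rule abelian_subgroupI3) (simp_all add: additive_subgroup_def sub M.abelian_group_axioms)
  let ?Q = "quotient_module M N"
  have NM: "N \<subseteq> carrier M" using sub by (auto dest: subgroup.subset)
  have carr: "carrier ?Q = \<pi> ` carrier M"
    by (auto simp: quotient_module_def A_RCOSETS_def' \<pi>_def)
  have add: "\<pi> x \<oplus>\<^bsub>?Q\<^esub> \<pi> y = \<pi> (x \<oplus>\<^bsub>M\<^esub> y)" if "x \<in> carrier M" "y \<in> carrier M" for x y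
    using that by (simp add: quotient_module_def \<pi>_def N.a_rcos_sum)
  have absorb: "\<pi> (h \<oplus>\<^bsub>M\<^esub> x) = \<pi> x" if "h \<in> N" "x \<in> carrier M" for h x
    unfolding \<pi>_def using that NM
    by (metis M.a_coset_add_assoc M.a_coset_join2 sub subsetD)
  have smult: "a \<odot>\<^bsub>?Q\<^esub> \<pi> x = \<pi> (a \<odot>\<^bsub>M\<^esub> x)" if "a \<in> carrier R" "x \<in> carrier M" for a x
  proof -
    \<comment> \<open>The scalar multiple of a coset is encoded as a union over its elements. All
      members of this union are the same coset, and the union is nonempty, so it equals that
      coset.\<close>
    have "\<pi> (a \<odot>\<^bsub>M\<^esub> y) = \<pi> (a \<odot>\<^bsub>M\<^esub> x)" if y: "y \<in> \<pi> x" for y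
    proof -
      obtain h where h: "h \<in> N" "y = h \<oplus>\<^bsub>M\<^esub> x"
        using y by (auto simp: \<pi>_def a_r_coset_def')
      then have "a \<odot>\<^bsub>M\<^esub> y = a \<odot>\<^bsub>M\<^esub> h \<oplus>\<^bsub>M\<^esub> a \<odot>\<^bsub>M\<^esub> x"
        using NM \<open>a \<in> carrier R\<close> \<open>x \<in> carrier M\<close> by (auto simp: M.smult_r_distr)
      then show ?thesis
        using absorb[of "a \<odot>\<^bsub>M\<^esub> h"] submodule.smult_closed[OF assms(2)] h that
          \<open>a \<in> carrier R\<close> \<open>x \<in> carrier M\<close> by simp
    qed
    moreover have "\<pi> x \<noteq> {}" using N.a_rcos_self that by (auto simp: \<pi>_def)
    ultimately show ?thesis by (auto simp: quotient_module_def \<pi>_def)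
  qed
  have zero: "\<zero>\<^bsub>?Q\<^esub> = \<pi> \<zero>\<^bsub>M\<^esub>"
    using M.a_coset_add_zero NM by (simp add: quotient_module_def \<pi>_def)
  show "\<pi> \<in> module_hom R M ?Q"
    by (rule module_homI) (use carr add smult in auto)
  show "\<pi> ` carrier M = carrier ?Q" using carr by simp
  show "\<pi> x = \<zero>\<^bsub>?Q\<^esub> \<longleftrightarrow> x \<in> N" if "x \<in> carrier M" for x
    using M.a_coset_join1[OF _ that sub] M.a_coset_join2[OF that sub]
    by (auto simp: quotient_module_def \<pi>_def)
  show "module R ?Q"
  proof (rule moduleI)
    show "cring R" by (rule M.R.cring_axioms)
    show "abelian_group ?Q"
    proof (rule abelian_groupI)
      show "\<exists>y\<in>carrier ?Q. y \<oplus>\<^bsub>?Q\<^esub> x = \<zero>\<^bsub>?Q\<^esub>" if "x \<in> carrier ?Q" for x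
      proof -
        obtain v where v: "v \<in> carrier M" "x = \<pi> v" using \<open>x \<in> carrier ?Q\<close> carr by auto
        then have "\<pi> (\<ominus>\<^bsub>M\<^esub> v) \<oplus>\<^bsub>?Q\<^esub> x = \<zero>\<^bsub>?Q\<^esub>"
          using add by (simp add: zero M.M.l_neg)
        then show ?thesis using carr v by auto
      qed
    qed (unfold carr zero; (elim imageE)?; simp add: add M.M.a_ac)+
  qed (unfold carr; (elim imageE)?; simp add: add smult M.smult_l_distr M.smult_r_distr M.smult_assoc1)+
qed

text \<open>This is projectivity of free modules, by induction on the number \<open>k\<close> of
  coordinates already treated: at stage \<open>k\<close> the map \<open>h\<close> is defined
  everywhere but is required to lift \<open>e\<close> only on vectors whose coordinates from
  \<open>k\<close> on vanish.\<close>

lemma free_module_lift: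
  assumes P: "module R P" and N: "module R N" and \<pi>: "\<pi> \<in> module_hom R P N"
    and surj: "\<pi> ` carrier P = carrier N" and e: "e \<in> module_hom R (free_module R n) N"
  shows "\<exists>h \<in> module_hom R (free_module R n) P. \<forall>x\<in>carrier (free_module R n). e x = \<pi> (h x)"
proof -
  interpret P: module R P by fact
  interpret N: module R N by fact
  let ?F = "free_module R n"
  interpret F: module R ?F by (rule free_module_module[OF P.R.cring_axioms])
  note \<pi>D = module_homD[OF \<pi>] and eD = module_homD[OF e]
  have F: "carrier ?F = {..<n} \<rightarrow>\<^sub>E carrier R"
    "\<zero>\<^bsub>?F\<^esub> = (\<lambda>i\<in>{..<n}. \<zero>\<^bsub>R\<^esub>)"
    "\<And>x y. x \<oplus>\<^bsub>?F\<^esub> y = (\<lambda>i\<in>{..<n}. x i \<oplus>\<^bsub>R\<^esub> y i)"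
    "\<And>a x. a \<odot>\<^bsub>?F\<^esub> x = (\<lambda>i\<in>{..<n}. a \<otimes>\<^bsub>R\<^esub> x i)"
    by (simp_all add: free_module_def function_module_def sub_module_of_ring_def)
  have "\<exists>h \<in> module_hom R ?F P. \<forall>x\<in>carrier ?F. (\<forall>i<n. k \<le> i \<longrightarrow> x i = \<zero>\<^bsub>R\<^esub>) \<longrightarrow> e x = \<pi> (h x)"
    if "k \<le> n" for k
    using that
  proof (induction k)
    case 0
    have "e x = \<pi> \<zero>\<^bsub>P\<^esub>" if "x \<in> carrier ?F" "\<forall>i<n. x i = \<zero>\<^bsub>R\<^esub>" for x
    proof -
      have "x = \<zero>\<^bsub>?F\<^esub>" using that by (auto simp: F PiE_def extensional_def restrict_def)
      then show ?thesis
        using module_hom_zero[OF e F.module_axioms N] module_hom_zero[OF \<pi> P N] by simp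
    qed
    moreover have "(\<lambda>_. \<zero>\<^bsub>P\<^esub>) \<in> module_hom R ?F P"
      by (rule module_homI) auto
    ultimately show ?case by (intro bexI[of _ "\<lambda>_. \<zero>\<^bsub>P\<^esub>"]) simp_all
  next
    case (Suc k)
    then obtain h where h: "h \<in> module_hom R ?F P"
      "\<forall>x\<in>carrier ?F. (\<forall>i<n. k \<le> i \<longrightarrow> x i = \<zero>\<^bsub>R\<^esub>) \<longrightarrow> e x = \<pi> (h x)"
      using Suc_leD by blast
    note hD = module_homD[OF h(1)]
    have k: "k < n" using Suc by simp
    define \<epsilon> where "\<epsilon> = (\<lambda>i\<in>{..<n}. if i = k then \<one>\<^bsub>R\<^esub> else \<zero>\<^bsub>R\<^esub>)"
    have \<epsilon>: "\<epsilon> \<in> carrier ?F" unfolding F(1) \<epsilon>_def by (intro restrict_PiE_iff[THEN iffD2]) simp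
    obtain u where u: "u \<in> carrier P" "\<pi> u = e \<epsilon>" using surj eD(1)[OF \<epsilon>] by (metis imageE)
    define del where "del x = x(k := \<zero>\<^bsub>R\<^esub>)" for x :: "nat \<Rightarrow> 'a"
    have xc: "x i \<in> carrier R" if "x \<in> carrier ?F" "i < n" for x i
      using that by (auto simp: F)
    have del: "del x \<in> carrier ?F" if "x \<in> carrier ?F" for x
      using that k by (auto simp: F del_def PiE_def extensional_def)
    have del_add: "del (x \<oplus>\<^bsub>?F\<^esub> y) = del x \<oplus>\<^bsub>?F\<^esub> del y" for x y
      using k by (auto simp: F del_def fun_eq_iff)
    have del_smult: "del (a \<odot>\<^bsub>?F\<^esub> x) = a \<odot>\<^bsub>?F\<^esub> del x" if "a \<in> carrier R" for a x
      using k that by (auto simp: F del_def fun_eq_iff)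
    have del_split: "x = del x \<oplus>\<^bsub>?F\<^esub> x k \<odot>\<^bsub>?F\<^esub> \<epsilon>" if x: "x \<in> carrier ?F" for x
    proof (rule ext)
      fix i show "x i = (del x \<oplus>\<^bsub>?F\<^esub> x k \<odot>\<^bsub>?F\<^esub> \<epsilon>) i"
        using x k xc[OF x] by (cases "i < n") (auto simp: F del_def \<epsilon>_def PiE_def extensional_def)
    qed
    \<comment> \<open>Deleting coordinate \<open>k\<close> before applying \<open>h\<close> leaves
      that coordinate to \<open>u\<close> alone, a preimage of the value of \<open>e\<close> at the
      basis vector \<epsilon>.\<close>
    define h' where "h' x = h (del x) \<oplus>\<^bsub>P\<^esub> x k \<odot>\<^bsub>P\<^esub> u" for x
    have "h' \<in> module_hom R ?F P"
    proof (rule module_homI)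
      show "h' x \<in> carrier P" if "x \<in> carrier ?F" for x
        using that hD(1) del u xc k by (simp add: h'_def)
      show "h' (x \<oplus>\<^bsub>?F\<^esub> y) = h' x \<oplus>\<^bsub>P\<^esub> h' y" if xy: "x \<in> carrier ?F" "y \<in> carrier ?F" for x y
      proof -
        have "(x \<oplus>\<^bsub>?F\<^esub> y) k = x k \<oplus>\<^bsub>R\<^esub> y k" using k by (simp add: F)
        then show ?thesis
          using xy hD del u xc k
          by (simp add: h'_def del_add P.smult_l_distr P.M.a_ac)
      qed
      show "h' (a \<odot>\<^bsub>?F\<^esub> x) = a \<odot>\<^bsub>P\<^esub> h' x" if ax: "a \<in> carrier R" "x \<in> carrier ?F" for a x
      proof -
        have "(a \<odot>\<^bsub>?F\<^esub> x) k = a \<otimes>\<^bsub>R\<^esub> x k" using k by (simp add: F)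
        then show ?thesis
          using ax hD del u xc k
          by (simp add: h'_def del_smult P.smult_r_distr P.smult_assoc1)
      qed
    qed
    moreover have "e x = \<pi> (h' x)"
      if x: "x \<in> carrier ?F" "\<forall>i<n. Suc k \<le> i \<longrightarrow> x i = \<zero>\<^bsub>R\<^esub>" for x
    proof -
      have "\<forall>i<n. k \<le> i \<longrightarrow> del x i = \<zero>\<^bsub>R\<^esub>" using x(2) by (auto simp: del_def)
      then have "e (del x) = \<pi> (h (del x))" using h(2) del x(1) by blast
      moreover have "e x = e (del x \<oplus>\<^bsub>?F\<^esub> x k \<odot>\<^bsub>?F\<^esub> \<epsilon>)" using del_split[OF x(1)] by simp
      ultimately have "e x = \<pi> (h (del x)) \<oplus>\<^bsub>N\<^esub> x k \<odot>\<^bsub>N\<^esub> \<pi> u"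
        using eD del[OF x(1)] xc[OF x(1) k] \<epsilon> u by simp
      then show ?thesis
        using \<pi>D hD del[OF x(1)] xc[OF x(1) k] u by (simp add: h'_def)
    qed
    ultimately show ?case by blast
  qed
  from this[of n] show ?thesis by (meson linorder_not_le order_refl)
qed

lemma hom_module_simps:
  "carrier (hom_module R M N) = module_hom R M N \<inter> extensional (carrier M)"
  "hom_module R M N\<lparr>carrier := Z\<rparr> = function_module (carrier M) N Z"
  by (simp_all add: hom_module_def function_module_def)

lemma hom_module_closed:
  assumes "module R M" "module R N"
  shows "(\<lambda>x\<in>carrier M. \<zero>\<^bsub>N\<^esub>) \<in> carrier (hom_module R M N)"
    and "f \<in> carrier (hom_module R M N) \<Longrightarrow> g \<in> carrier (hom_module R M N) \<Longrightarrow>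
      (\<lambda>x\<in>carrier M. f x \<oplus>\<^bsub>N\<^esub> g x) \<in> carrier (hom_module R M N)"
    and "a \<in> carrier R \<Longrightarrow> f \<in> carrier (hom_module R M N) \<Longrightarrow>
      (\<lambda>x\<in>carrier M. a \<odot>\<^bsub>N\<^esub> f x) \<in> carrier (hom_module R M N)"
proof -
  interpret M: module R M by fact
  interpret N: module R N by fact
  show "(\<lambda>x\<in>carrier M. \<zero>\<^bsub>N\<^esub>) \<in> carrier (hom_module R M N)"
    by (auto simp: hom_module_simps intro!: module_homI)
  show "(\<lambda>x\<in>carrier M. f x \<oplus>\<^bsub>N\<^esub> g x) \<in> carrier (hom_module R M N)"
    if "f \<in> carrier (hom_module R M N)" "g \<in> carrier (hom_module R M N)"
  proof -
    have fg: "f \<in> module_hom R M N" "g \<in> module_hom R M N"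
      using that by (auto simp: hom_module_simps)
    show ?thesis
      using module_homD[OF fg(1)] module_homD[OF fg(2)]
      by (auto simp: hom_module_simps N.smult_r_distr N.M.a_ac intro!: module_homI)
  qed
  show "(\<lambda>x\<in>carrier M. a \<odot>\<^bsub>N\<^esub> f x) \<in> carrier (hom_module R M N)"
    if "a \<in> carrier R" "f \<in> carrier (hom_module R M N)"
  proof -
    have f: "f \<in> module_hom R M N"
      using that by (auto simp: hom_module_simps)
    show ?thesis
      using module_homD[OF f] \<open>a \<in> carrier R\<close>
      by (auto simp: hom_module_simps N.smult_r_distr N.smult_assoc1[symmetric] M.R.m_comm
          intro!: module_homI)
  qed
qed

section \<open>Ext in degree one and homomorphisms on the maximal ideal\<close>

lemma (in cring) maximalideal_inverse_mod:
  assumes "maximalideal m R" "b \<in> carrier R" "b \<notin> m"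
  shows "\<exists>p\<in>m. \<exists>c\<in>carrier R. \<one> = p \<oplus> c \<otimes> b"
proof -
  interpret m: maximalideal m R by fact
  have J: "ideal (m <+>\<^bsub>R\<^esub> PIdl b) R"
    by (rule add_ideals[OF m.is_ideal cgenideal_ideal[OF assms(2)]])
  have el: "x \<in> m <+>\<^bsub>R\<^esub> PIdl b \<longleftrightarrow> (\<exists>p\<in>m. \<exists>c\<in>carrier R. x = p \<oplus> c \<otimes> b)" for x
    by (auto simp: set_add_def' cgenideal_def)
  have "m \<subseteq> m <+>\<^bsub>R\<^esub> PIdl b"
  proof
    fix x assume "x \<in> m"
    then have "x = x \<oplus> \<zero> \<otimes> b" using assms(2) m.Icarr by simp
    then show "x \<in> m <+>\<^bsub>R\<^esub> PIdl b" unfolding el using \<open>x \<in> m\<close> by blast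
  qed
  moreover have "b \<in> m <+>\<^bsub>R\<^esub> PIdl b"
  proof -
    have "b = \<zero> \<oplus> \<one> \<otimes> b" using assms(2) by simp
    then show ?thesis
      unfolding el using additive_subgroup.zero_closed[OF m.additive_subgroup_axioms] by blast
  qed
  moreover have "m <+>\<^bsub>R\<^esub> PIdl b \<subseteq> carrier R"
    using J by (simp add: ideal.Icarr subsetI)
  ultimately have "m <+>\<^bsub>R\<^esub> PIdl b = carrier R"
    using m.I_maximal[OF J] assms(3) by blast
  then show ?thesis using el[of \<one>] by simp
qed

text \<open>If \<open>h\<close> lifts the augmentation of a resolution of \<open>R/m\<close> to a map into \<open>R\<close>, then \<open>h \<circ> d 0\<close> takes values
  in \<open>m\<close>, and \<open>\<eta> \<mapsto> \<eta> \<circ> h \<circ> d 0\<close> embeds the homomorphisms \<open>m \<rightarrow> W\<close>, modulo those of the form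
  \<open>p \<mapsto> p w\<close>, into \<open>Ext\<^sup>1(R/m, W)\<close>.\<close>

lemma ext1_dimension_one:
  fixes R :: "('a, 'm) ring_scheme" and W :: "('a, 'w, 'p) module_scheme"
  assumes R: "cring R" and max: "maximalideal (max_ideal R) R" and W: "module R W"
    and ext1: "ext_isomorphic R 1 (residue_field_module R) W (residue_field_module R)"
    and \<eta>: "\<eta> \<in> module_hom R (sub_module_of_ring R (max_ideal R)) W"
    and \<eta>': "\<eta>' \<in> module_hom R (sub_module_of_ring R (max_ideal R)) W"
    and nontrivial: "\<not> (\<exists>w\<in>carrier W. \<forall>p\<in>max_ideal R. \<eta>' p = p \<odot>\<^bsub>W\<^esub> w)"
  shows "\<exists>r\<in>carrier R. \<exists>w\<in>carrier W. \<forall>p\<in>max_ideal R. \<eta> p = r \<odot>\<^bsub>W\<^esub> \<eta>' p \<oplus>\<^bsub>W\<^esub> p \<odot>\<^bsub>W\<^esub> w"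
proof -
  interpret R: cring R by fact
  interpret W: module R W by fact
  define m where "m = max_ideal R"
  interpret m: maximalideal m R using max by (simp add: m_def)
  let ?Rm = "sub_module_of_ring R (carrier R)"
  let ?K = "residue_field_module R"
  have Rm: "module R ?Rm" by (rule ring_module[OF R])
  have Rms: "carrier ?Rm = carrier R" "\<zero>\<^bsub>?Rm\<^esub> = \<zero>\<^bsub>R\<^esub>" "x \<oplus>\<^bsub>?Rm\<^esub> y = x \<oplus>\<^bsub>R\<^esub> y"
    "x \<odot>\<^bsub>?Rm\<^esub> y = x \<otimes>\<^bsub>R\<^esub> y" for x y
    by (simp_all add: sub_module_of_ring_def)
  have mm: "p \<in> carrier R" if "p \<in> m" for p using that m.Icarr by simp
  have m_sub: "submodule m R ?Rm"
    by (rule submodule_scalarI[OF Rm])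
      (auto simp: Rms mm m.I_l_closed additive_subgroup.zero_closed[OF m.additive_subgroup_axioms]
        additive_subgroup.a_closed[OF m.additive_subgroup_axioms])
  define \<pi> where "\<pi> = a_r_coset ?Rm m"
  have Keq: "?K = quotient_module ?Rm m" by (simp add: residue_field_module_def m_def)
  note K = quotient_module[OF Rm m_sub, folded Keq \<pi>_def]
  note \<pi>D = module_homD[OF K(2), unfolded Rms]
  interpret K: module R ?K by (rule K(1))
  obtain b e d where res: "free_resolution R ?K b e d"
    and iso: "module_isomorphic R (ext_of_resolution R W b d 1) ?K"
    using ext1 by (auto simp: ext_isomorphic_def)
  define F where "F i = free_module R (b i)" for i
  have F: "module R (F i)" for i unfolding F_def by (rule free_module_module[OF R])
  have e: "e \<in> module_hom R (F 0) ?K" and d: "\<And>i. d i \<in> module_hom R (F (Suc i)) (F i)"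
    and e_surj: "e ` carrier (F 0) = carrier ?K"
    and ex0: "d 0 ` carrier (F (Suc 0)) = a_kernel (F 0) ?K e"
    and ex: "\<And>i. d (Suc i) ` carrier (F (Suc (Suc i))) = a_kernel (F (Suc i)) (F i) (d i)"
    using res by (simp_all add: free_resolution_def Let_def F_def)
  note eD = module_homD[OF e]
  interpret F0: module R "F 0" by (rule F)
  interpret F1: module R "F (Suc 0)" by (rule F)
  \<comment> \<open>Lifting \<open>e\<close> along \<pi> gives a map to \<open>R\<close> itself.
    Exactness then says that the image of \<open>d 0\<close> is the preimage of \<open>m\<close>
    under \<open>h\<close>.\<close>
  have "\<exists>h \<in> module_hom R (F 0) ?Rm. \<forall>x\<in>carrier (F 0). e x = \<pi> (h x)"
    unfolding F_def
    by (rule free_module_lift[OF Rm K(1) K(2) K(3)]) (use e in \<open>simp add: F_def\<close>)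
  then obtain h where h: "h \<in> module_hom R (F 0) ?Rm"
    and eh: "\<And>x. x \<in> carrier (F 0) \<Longrightarrow> e x = \<pi> (h x)" by blast
  note hD = module_homD[OF h, unfolded Rms]
  have ker: "x \<in> a_kernel (F 0) ?K e \<longleftrightarrow> x \<in> carrier (F 0) \<and> h x \<in> m" for x
    using eh K(4) hD(1) by (auto simp: a_kernel_def' Rms)
  have d0: "d 0 x \<in> carrier (F 0)" "h (d 0 x) \<in> m" if "x \<in> carrier (F 1)" for x
    using ex0 ker that by auto
  have d01: "d 0 (d 1 x) = \<zero>\<^bsub>F 0\<^esub>" if "x \<in> carrier (F 2)" for x
    using ex[of 0] that by (auto simp: a_kernel_def' numeral_2_eq_2)
  have d1: "d 1 x \<in> carrier (F 1)" if "x \<in> carrier (F 2)" for x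
    using module_homD(1)[OF d[of 1]] that by (simp add: numeral_2_eq_2)
  \<comment> \<open>The lift satisfies \<open>h v = 1 + q\<close> with \<open>q\<close> in
    \<open>m\<close>, not necessarily \<open>h v = 1\<close>. The error \<open>q\<close> reappears
    below as the correction \<theta> q.\<close>
  obtain v where v: "v \<in> carrier (F 0)" "e v = \<pi> \<one>\<^bsub>R\<^esub>"
    using e_surj \<pi>D(1)[of "\<one>\<^bsub>R\<^esub>"] by (metis R.one_closed imageE)
  have hv: "h v \<in> carrier R" using hD(1) v by blast
  define q where "q = h v \<ominus>\<^bsub>R\<^esub> \<one>\<^bsub>R\<^esub>"
  have qc: "q \<in> carrier R" using hv by (simp add: q_def)
  have hvq: "h v = \<one>\<^bsub>R\<^esub> \<oplus>\<^bsub>R\<^esub> q"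
    using hv by (simp add: q_def R.minus_eq R.a_comm[of "\<one>\<^bsub>R\<^esub>"] R.a_assoc R.l_neg)
  have "\<pi> \<one>\<^bsub>R\<^esub> \<oplus>\<^bsub>?K\<^esub> \<pi> q = \<pi> \<one>\<^bsub>R\<^esub>"
    using \<pi>D(2)[of "\<one>\<^bsub>R\<^esub>" q] qc hvq eh[OF v(1)] v(2) by simp
  then have "\<pi> q = \<zero>\<^bsub>?K\<^esub>"
    using \<pi>D(1) qc by (metis K.M.add.r_cancel_one' K.M.a_comm R.one_closed)
  then have q: "q \<in> m" using K(4)[of q] qc by (simp add: Rms)
  define Z where "Z = ext_cocycles R W b d 1"
  define Bd where "Bd = ext_coboundaries R W b d 1"
  define E where "E = function_module (carrier (F 1)) W Z"
  have Z_iff: "f \<in> Z \<longleftrightarrow> f \<in> carrier (hom_module R (F 1) W) \<and>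
      (\<forall>x\<in>carrier (F 2). f (d 1 x) = \<zero>\<^bsub>W\<^esub>)" for f
    by (simp add: Z_def ext_cocycles_def F_def numeral_2_eq_2)
  have Bd_iff: "f \<in> Bd \<longleftrightarrow> (\<exists>g\<in>carrier (hom_module R (F 0) W). f = compose (carrier (F 1)) g (d 0))"
    for f
    unfolding Bd_def F_def One_nat_def ext_coboundaries.simps by blast
  have E_simps: "carrier E = Z" "f \<oplus>\<^bsub>E\<^esub> g = (\<lambda>x\<in>carrier (F 1). f x \<oplus>\<^bsub>W\<^esub> g x)"
    "a \<odot>\<^bsub>E\<^esub> f = (\<lambda>x\<in>carrier (F 1). a \<odot>\<^bsub>W\<^esub> f x)"
    "\<zero>\<^bsub>E\<^esub> = (\<lambda>x\<in>carrier (F 1). \<zero>\<^bsub>W\<^esub>)" for f g a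
    by (simp_all add: E_def function_module_def)
  have E: "module R E"
    unfolding E_def
  proof (rule function_module_module[OF W])
    show "Z \<subseteq> carrier (F 1) \<rightarrow>\<^sub>E carrier W"
      by (auto simp: Z_iff hom_module_simps module_hom_def PiE_def)
  qed (use hom_module_closed[OF F W] d1 in \<open>auto simp: Z_iff\<close>)
  have Bd_sub: "submodule Bd R E"
  proof (rule submodule_scalarI[OF E])
    show "Bd \<subseteq> carrier E"
    proof
      fix f assume "f \<in> Bd"
      then obtain g where g: "g \<in> module_hom R (F 0) W" "f = compose (carrier (F 1)) g (d 0)"
        by (auto simp: Bd_iff hom_module_simps)
      note gD = module_homD[OF g(1)]
      have "f \<in> module_hom R (F 1) W"
        by (rule module_homI) (use g(2) gD module_homD(2,3)[OF d[of 0]] d0(1) in \<open>auto simp: compose_def\<close>)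
      moreover have "f (d 1 x) = \<zero>\<^bsub>W\<^esub>" if "x \<in> carrier (F 2)" for x
        using that d1 d01 g(2) module_hom_zero[OF g(1) F W] by (simp add: compose_def)
      ultimately show "f \<in> carrier E" using g(2) by (simp add: E_simps Z_iff hom_module_simps)
    qed
    have "\<zero>\<^bsub>E\<^esub> = compose (carrier (F 1)) (\<lambda>x\<in>carrier (F 0). \<zero>\<^bsub>W\<^esub>) (d 0)"
      using d0(1) by (auto simp: E_simps compose_def restrict_def)
    then show "\<zero>\<^bsub>E\<^esub> \<in> Bd" using hom_module_closed(1)[OF F W] Bd_iff by blast
  next
    fix f g assume "f \<in> Bd" "g \<in> Bd"
    then obtain f' g' where fg: "f' \<in> carrier (hom_module R (F 0) W)"
      "g' \<in> carrier (hom_module R (F 0) W)"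
      "f = compose (carrier (F 1)) f' (d 0)" "g = compose (carrier (F 1)) g' (d 0)"
      by (auto simp: Bd_iff)
    then have "f \<oplus>\<^bsub>E\<^esub> g = compose (carrier (F 1)) (\<lambda>x\<in>carrier (F 0). f' x \<oplus>\<^bsub>W\<^esub> g' x) (d 0)"
      using d0(1) by (auto simp: E_simps compose_def restrict_def)
    then show "f \<oplus>\<^bsub>E\<^esub> g \<in> Bd" using hom_module_closed(2)[OF F W fg(1,2)] Bd_iff by blast
  next
    fix a f assume a: "a \<in> carrier R" and "f \<in> Bd"
    then obtain f' where f: "f' \<in> carrier (hom_module R (F 0) W)"
      "f = compose (carrier (F 1)) f' (d 0)"
      by (auto simp: Bd_iff)
    then have "a \<odot>\<^bsub>E\<^esub> f = compose (carrier (F 1)) (\<lambda>x\<in>carrier (F 0). a \<odot>\<^bsub>W\<^esub> f' x) (d 0)"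
      using d0(1) by (auto simp: E_simps compose_def restrict_def)
    then show "a \<odot>\<^bsub>E\<^esub> f \<in> Bd" using hom_module_closed(3)[OF F W a f(1)] Bd_iff by blast
  qed
  define \<rho> where "\<rho> = a_r_coset E Bd"
  let ?X = "quotient_module E Bd"
  note Q = quotient_module[OF E Bd_sub, folded \<rho>_def]
  have "ext_of_resolution R W b d 1 = ?X"
    unfolding ext_of_resolution_def hom_module_simps(2) E_def F_def Z_def Bd_def by simp
  then obtain \<Phi> where \<Phi>: "\<Phi> \<in> module_hom R ?X ?K" "inj_on \<Phi> (carrier ?X)"
    using iso by (auto simp: module_isomorphic_def bij_betw_def)
  define \<psi> where "\<psi> f = \<Phi> (\<rho> f)" for f
  note \<rho>D = module_homD[OF Q(2)] and \<Phi>D = module_homD[OF \<Phi>(1)]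
  have \<psi>: "\<psi> \<in> module_hom R E ?K"
    by (rule module_homI) (use \<rho>D \<Phi>D in \<open>auto simp: \<psi>_def\<close>)
  note \<psi>D = module_homD[OF \<psi>, unfolded E_simps(1)]
  have \<psi>_zero: "f \<in> Bd" if "f \<in> Z" "\<psi> f = \<zero>\<^bsub>?K\<^esub>" for f
  proof -
    interpret X: module R ?X by (rule Q(1))
    have "\<Phi> (\<rho> f) = \<Phi> \<zero>\<^bsub>?X\<^esub>"
      using that module_hom_zero[OF \<Phi>(1) Q(1) K(1)] by (simp add: \<psi>_def)
    then have "\<rho> f = \<zero>\<^bsub>?X\<^esub>"
      using \<Phi>(2) \<rho>D(1)[of f] that by (auto simp: inj_on_def E_simps)
    then show ?thesis using Q(4)[of f] that by (simp add: E_simps)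
  qed
  define c where "c \<theta> = (\<lambda>x\<in>carrier (F 1). \<theta> (h (d 0 x)))" for \<theta> :: "'a \<Rightarrow> 'w"
  let ?m = "sub_module_of_ring R m"
  have ms: "carrier ?m = m" "\<zero>\<^bsub>?m\<^esub> = \<zero>\<^bsub>R\<^esub>" "x \<oplus>\<^bsub>?m\<^esub> y = x \<oplus>\<^bsub>R\<^esub> y"
    "x \<odot>\<^bsub>?m\<^esub> y = x \<otimes>\<^bsub>R\<^esub> y" for x y
    by (simp_all add: sub_module_of_ring_def)
  have zero_m: "\<zero>\<^bsub>R\<^esub> \<in> m"
    using additive_subgroup.zero_closed[OF m.additive_subgroup_axioms] .
  have cZ: "c \<theta> \<in> Z" if \<theta>: "\<theta> \<in> module_hom R ?m W" for \<theta>
  proof -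
    note \<theta>D = module_homD[OF \<theta>, unfolded ms]
    have "\<theta> \<zero>\<^bsub>R\<^esub> = \<zero>\<^bsub>W\<^esub>"
      using \<theta>D(3)[OF R.zero_closed zero_m] \<theta>D(1)[OF zero_m] by simp
    moreover have "h \<zero>\<^bsub>F 0\<^esub> = \<zero>\<^bsub>R\<^esub>"
      using module_hom_zero[OF h F Rm] by (simp add: Rms)
    moreover have "c \<theta> \<in> module_hom R (F 1) W"
      by (rule module_homI) (use \<theta>D d0 module_homD(2,3)[OF d[of 0]] hD in \<open>auto simp: c_def\<close>)
    ultimately show ?thesis
      using d1 d01 by (auto simp: Z_iff hom_module_simps c_def)
  qed
  have trivial: "\<exists>w\<in>carrier W. \<forall>p\<in>m. \<theta> p = p \<odot>\<^bsub>W\<^esub> w"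
    if \<theta>: "\<theta> \<in> module_hom R ?m W" and cB: "c \<theta> \<in> Bd" for \<theta>
  proof -
    note \<theta>D = module_homD[OF \<theta>, unfolded ms]
    obtain g where g: "g \<in> module_hom R (F 0) W" "c \<theta> = compose (carrier (F 1)) g (d 0)"
      using cB by (auto simp: Bd_iff hom_module_simps)
    note gD = module_homD[OF g(1)]
    have gv: "g v \<in> carrier W" using gD(1) v by blast
    have \<theta>q: "\<theta> q \<in> carrier W" using \<theta>D(1) q by blast
    \<comment> \<open>Since \<open>h\<close> sends \<open>p v\<close> to \<open>p + p q\<close> in
      \<open>m\<close>, the vector \<open>p v\<close> is some \<open>d 0 y\<close>. Comparing
      \<theta> after \<open>h\<close> with \<open>g\<close> there gives \<theta> p + p \<theta> q =
      p g v.\<close>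
    have "\<theta> p = p \<odot>\<^bsub>W\<^esub> (g v \<ominus>\<^bsub>W\<^esub> \<theta> q)" if p: "p \<in> m" for p
    proof -
      have pc: "p \<in> carrier R" using mm p by blast
      have hpv: "h (p \<odot>\<^bsub>F 0\<^esub> v) = p \<oplus>\<^bsub>R\<^esub> p \<otimes>\<^bsub>R\<^esub> q"
        using hD(3)[OF pc v(1)] hvq pc qc by (simp add: R.r_distr)
      have pq: "p \<otimes>\<^bsub>R\<^esub> q \<in> m" using m.I_l_closed q pc by blast
      then have "h (p \<odot>\<^bsub>F 0\<^esub> v) \<in> m"
        using hpv p additive_subgroup.a_closed[OF m.additive_subgroup_axioms] by simp
      then have "p \<odot>\<^bsub>F 0\<^esub> v \<in> a_kernel (F 0) ?K e" using ker pc v by simp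
      then obtain y where y: "y \<in> carrier (F 1)" "d 0 y = p \<odot>\<^bsub>F 0\<^esub> v"
        using ex0 by (metis One_nat_def imageE)
      have "\<theta> (h (d 0 y)) = g (d 0 y)"
        using fun_cong[OF g(2), of y] y(1) by (simp add: c_def compose_def)
      then have "\<theta> p \<oplus>\<^bsub>W\<^esub> p \<odot>\<^bsub>W\<^esub> \<theta> q = p \<odot>\<^bsub>W\<^esub> g v"
        using \<theta>D(2)[OF p pq] \<theta>D(3)[OF pc q] gD(3)[OF pc v(1)] by (simp add: y(2) hpv)
      then have "\<theta> p = p \<odot>\<^bsub>W\<^esub> g v \<ominus>\<^bsub>W\<^esub> p \<odot>\<^bsub>W\<^esub> \<theta> q"
        using \<theta>D(1)[OF p] pc \<theta>q gv by (metis W.M.minus_eq W.M.add.inv_solve_right W.smult_closed)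
      then show ?thesis
        using pc gv \<theta>q by (simp add: W.M.minus_eq W.smult_r_distr W.smult_r_minus)
    qed
    then show ?thesis using gv \<theta>q by blast
  qed
  have \<eta>h: "\<eta> \<in> module_hom R ?m W" "\<eta>' \<in> module_hom R ?m W"
    using \<eta> \<eta>' by (simp_all add: m_def)
  note \<eta>D = module_homD[OF \<eta>h(1), unfolded ms] and \<eta>'D = module_homD[OF \<eta>h(2), unfolded ms]
  obtain \<alpha> where \<alpha>: "\<alpha> \<in> carrier R" "\<psi> (c \<eta>) = \<pi> \<alpha>"
    using \<psi>D(1)[OF cZ[OF \<eta>h(1)]] K(3) by (auto simp: Rms)
  obtain \<beta> where \<beta>: "\<beta> \<in> carrier R" "\<psi> (c \<eta>') = \<pi> \<beta>"
    using \<psi>D(1)[OF cZ[OF \<eta>h(2)]] K(3) by (auto simp: Rms)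
  have "\<beta> \<notin> m"
  proof
    assume "\<beta> \<in> m"
    then have "\<psi> (c \<eta>') = \<zero>\<^bsub>?K\<^esub>" using \<beta> K(4)[of \<beta>] by (simp add: Rms)
    then have "c \<eta>' \<in> Bd" using \<psi>_zero cZ[OF \<eta>h(2)] by blast
    then show False using trivial[OF \<eta>h(2)] nontrivial by (simp add: m_def)
  qed
  then obtain p0 b' where b': "p0 \<in> m" "b' \<in> carrier R" "\<one>\<^bsub>R\<^esub> = p0 \<oplus>\<^bsub>R\<^esub> b' \<otimes>\<^bsub>R\<^esub> \<beta>"
    using R.maximalideal_inverse_mod[OF m.is_maximalideal \<beta>(1)] by blast
  \<comment> \<open>Since \<open>b'\<close> inverts \<beta> modulo \<open>m\<close>, this
    \<open>r\<close> makes the classes of \<open>c \<eta>\<close> and \<open>r\<close> times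
    \<open>c \<eta>'\<close> agree; their difference comes from the \<theta> below, whose class is
    therefore zero.\<close>
  define r where "r = \<alpha> \<otimes>\<^bsub>R\<^esub> b'"
  have rc: "r \<in> carrier R" using \<alpha> b' by (simp add: r_def)
  define \<theta> where "\<theta> p = \<eta> p \<ominus>\<^bsub>W\<^esub> r \<odot>\<^bsub>W\<^esub> \<eta>' p" for p
  have \<theta>: "\<theta> \<in> module_hom R ?m W"
  proof (rule module_homI, unfold ms)
    show "\<theta> x \<in> carrier W" if "x \<in> m" for x
      using that \<eta>D(1) \<eta>'D(1) rc by (simp add: \<theta>_def)
    show "\<theta> (x \<oplus>\<^bsub>R\<^esub> y) = \<theta> x \<oplus>\<^bsub>W\<^esub> \<theta> y" if "x \<in> m" "y \<in> m" for x y
      using that \<eta>D(1,2) \<eta>'D(1,2) rc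
      by (simp add: \<theta>_def W.M.minus_eq W.smult_r_distr W.M.minus_add W.M.a_ac)
    show "\<theta> (a \<otimes>\<^bsub>R\<^esub> x) = a \<odot>\<^bsub>W\<^esub> \<theta> x" if "a \<in> carrier R" "x \<in> m" for a x
      using that \<eta>D(1,3) \<eta>'D(1,3) rc
      by (simp add: \<theta>_def W.M.minus_eq W.smult_r_distr W.smult_r_minus
          W.smult_assoc1[symmetric] R.m_comm)
  qed
  note \<theta>D = module_homD[OF \<theta>, unfolded ms]
  have split: "\<eta> p = r \<odot>\<^bsub>W\<^esub> \<eta>' p \<oplus>\<^bsub>W\<^esub> \<theta> p" if "p \<in> m" for p
    using \<eta>D(1) \<eta>'D(1) rc that
    by (simp add: \<theta>_def W.M.minus_eq W.M.a_lcomm[of _ "\<eta> p"] W.M.r_neg)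
  have "c \<eta> = r \<odot>\<^bsub>E\<^esub> c \<eta>' \<oplus>\<^bsub>E\<^esub> c \<theta>"
    using split d0 by (auto simp: c_def E_simps restrict_def)
  then have "\<psi> (c \<eta>) = r \<odot>\<^bsub>?K\<^esub> \<psi> (c \<eta>') \<oplus>\<^bsub>?K\<^esub> \<psi> (c \<theta>)"
    using \<psi>D cZ \<eta>h \<theta> rc module.smult_closed[OF E rc] by (simp add: E_simps(1))
  then have "\<pi> \<alpha> = \<pi> (r \<otimes>\<^bsub>R\<^esub> \<beta>) \<oplus>\<^bsub>?K\<^esub> \<psi> (c \<theta>)"
    using \<alpha> \<beta> \<pi>D(3)[OF rc \<beta>(1)] by simp
  moreover have "\<pi> \<alpha> = \<pi> (r \<otimes>\<^bsub>R\<^esub> \<beta>)"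
  proof -
    have "\<alpha> = r \<otimes>\<^bsub>R\<^esub> \<beta> \<oplus>\<^bsub>R\<^esub> \<alpha> \<otimes>\<^bsub>R\<^esub> p0"
    proof -
      have "\<alpha> = \<alpha> \<otimes>\<^bsub>R\<^esub> (p0 \<oplus>\<^bsub>R\<^esub> b' \<otimes>\<^bsub>R\<^esub> \<beta>)" using b'(3)[symmetric] \<alpha> by simp
      also have "\<dots> = r \<otimes>\<^bsub>R\<^esub> \<beta> \<oplus>\<^bsub>R\<^esub> \<alpha> \<otimes>\<^bsub>R\<^esub> p0"
        using \<alpha> \<beta> b' mm by (simp add: r_def R.r_distr R.m_assoc R.a_comm)
      finally show ?thesis .
    qed
    moreover have "\<alpha> \<otimes>\<^bsub>R\<^esub> p0 \<in> m" using m.I_l_closed \<alpha> b' by blast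
    then have "\<pi> (\<alpha> \<otimes>\<^bsub>R\<^esub> p0) = \<zero>\<^bsub>?K\<^esub>" using K(4)[of "\<alpha> \<otimes>\<^bsub>R\<^esub> p0"] mm by (simp add: Rms)
    ultimately show ?thesis
      using \<pi>D(1,2) rc \<beta> \<alpha> b' mm
      by (metis K.M.r_zero R.m_closed)
  qed
  ultimately have "\<psi> (c \<theta>) = \<zero>\<^bsub>?K\<^esub>"
    using \<psi>D(1)[OF cZ[OF \<theta>]] \<pi>D(1) \<alpha>
    by (metis K.M.add.r_cancel_one' K.M.a_comm)
  then have "c \<theta> \<in> Bd" using \<psi>_zero cZ[OF \<theta>] by blast
  then obtain w where "w \<in> carrier W" "\<forall>p\<in>m. \<theta> p = p \<odot>\<^bsub>W\<^esub> w" using trivial[OF \<theta>] by blast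
  then show ?thesis using split rc by (intro bexI[of _ r] bexI[of _ w]) (simp_all add: m_def)
qed

section \<open>Local rings of dimension one\<close>

lemma (in cring) exists_maximalideal:
  assumes I: "ideal I R" and one: "\<one> \<notin> I"
  shows "\<exists>J. maximalideal J R \<and> I \<subseteq> J"
proof -
  define F where "F = {J. ideal J R \<and> I \<subseteq> J \<and> \<one> \<notin> J}"
  have "\<exists>J\<in>F. \<forall>L\<in>F. J \<subseteq> L \<longrightarrow> L = J"
  proof (rule subset_Zorn_nonempty)
    show "F \<noteq> {}" using assms by (auto simp: F_def)
    fix \<C> assume \<C>: "\<C> \<noteq> {}" "subset.chain F \<C>"
    then have "subset.chain {J. ideal J R} \<C>"
      by (auto simp: F_def subset.chain_def)
    then have "ideal (\<Union>\<C>) R" using chain_Union_is_ideal[of \<C>] \<C>(1) by simp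
    then show "\<Union>\<C> \<in> F"
      using \<C> by (auto simp: F_def subset.chain_def)
  qed
  then obtain J where J: "J \<in> F" and J_max: "\<And>L. L \<in> F \<Longrightarrow> J \<subseteq> L \<Longrightarrow> L = J" by blast
  have "maximalideal J R"
  proof (rule maximalidealI)
    show "ideal J R" using J by (simp add: F_def)
    show "carrier R \<noteq> J" using J by (auto simp: F_def)
    fix L assume L: "ideal L R" "J \<subseteq> L" "L \<subseteq> carrier R"
    show "L = J \<or> L = carrier R"
    proof (cases "\<one> \<in> L")
      case True
      then show ?thesis using ideal.one_imp_carrier[OF L(1)] by simp
    next
      case False
      then have "L \<in> F" using L J by (auto simp: F_def)
      then show ?thesis using J_max L(2) by blast
    qed
  qed
  then show ?thesis using J by (auto simp: F_def)
qed

lemma local_ring_maximalideal: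
  assumes "local_ring R"
  shows "maximalideal (max_ideal R) R"
  using assms theI'[of "\<lambda>I. maximalideal I R"] by (simp add: local_ring_def max_ideal_def)

lemma local_ring_max_ideal_unique:
  assumes "local_ring R" "maximalideal I R"
  shows "I = max_ideal R"
  using assms local_ring_maximalideal[OF assms(1)] by (auto simp: local_ring_def)

lemma local_ring_ideal_subset:
  assumes "local_ring R" "ideal I R" "\<one>\<^bsub>R\<^esub> \<notin> I"
  shows "I \<subseteq> max_ideal R"
proof -
  interpret cring R using assms(1) by (simp add: local_ring_def)
  obtain J where "maximalideal J R" "I \<subseteq> J" using exists_maximalideal assms by blast
  then show ?thesis using local_ring_max_ideal_unique[OF assms(1)] by blast
qed

text \<open>Non-units lie in the maximal ideal, so they are closed under addition. In this
  elementwise form the locality of the integral closure is used later.\<close>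

lemma local_ring_unit_of_add:
  fixes R (structure)
  assumes "local_ring R" "x \<in> carrier R" "y \<in> carrier R" "x \<oplus>\<^bsub>R\<^esub> y \<in> Units R"
  shows "x \<in> Units R \<or> y \<in> Units R"
proof -
  interpret cring R using assms(1) by (simp add: local_ring_def)
  interpret P: maximalideal "max_ideal R" R by (rule local_ring_maximalideal[OF assms(1)])
  have nonunit: "z \<in> max_ideal R" if "z \<in> carrier R" "z \<notin> Units R" for z
  proof -
    have "\<one> \<notin> PIdl z"
    proof
      assume "\<one> \<in> PIdl z"
      then obtain w where "w \<in> carrier R" "\<one> = w \<otimes> z" by (auto simp: cgenideal_def)
      then have "z \<in> Units R" using that(1) by (auto simp: Units_def m_comm)
      then show False using that(2) by simp
    qed
    then have "PIdl z \<subseteq> max_ideal R"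
      using local_ring_ideal_subset[OF assms(1) cgenideal_ideal[OF that(1)]] by blast
    then show ?thesis using cgenideal_self[OF that(1)] by blast
  qed
  show ?thesis
  proof (rule ccontr)
    assume "\<not> ?thesis"
    then have "x \<oplus> y \<in> max_ideal R"
      using nonunit assms(2,3) by (simp add: additive_subgroup.a_closed[OF P.additive_subgroup_axioms])
    then have "\<one> \<in> max_ideal R"
      using P.I_l_closed[of "x \<oplus> y" "inv (x \<oplus> y)"] assms(4) by simp
    then have "max_ideal R = carrier R"
      using P.one_imp_carrier by simp
    then show False using P.I_notcarr by simp
  qed
qed

lemma depth_one_nonzerodivisor:
  fixes R (structure)
  assumes "cring R" "depth R = 1"
  shows "\<exists>t \<in> non_zerodivisors R. t \<in> max_ideal R"
proof -
  interpret cring R by fact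
  have "\<exists>xs. regular_sequence R xs \<and> set xs \<subseteq> max_ideal R \<and> xs \<noteq> []"
  proof (rule ccontr)
    assume "\<not> ?thesis"
    then have "depth R \<le> 0"
      unfolding depth_def by (intro Sup_least) (auto simp: enat_0)
    then show False using assms(2) by simp
  qed
  then obtain t ts where t: "regular_sequence R (t # ts)" "t \<in> max_ideal R"
    by (metis list.exhaust list.set_intros(1) subsetD)
  \<comment> \<open>The first entry of a regular sequence is tested modulo the ideal of its empty
    list of predecessors, so this identity turns regularity into being a nonzerodivisor.\<close>
  have "Idl {} = {\<zero>}"
    using genideal_minimal[OF zeroideal, of "{}"] genideal_ideal[of "{}"]
    by (auto dest: ideal.axioms(1) additive_subgroup.zero_closed)
  then have "t \<in> non_zerodivisors R"
    using t(1) by (force simp: regular_sequence_def non_zerodivisors_def)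
  then show ?thesis using t(2) by blast
qed

lemma krull_dim_one_chain:
  assumes "krull_dim R = 1" "primeideal P R" "primeideal P' R" "primeideal P'' R"
  shows "\<not> (P \<subset> P' \<and> P' \<subset> P'')"
proof
  assume "P \<subset> P' \<and> P' \<subset> P''"
  define c :: "nat \<Rightarrow> 'a set" where "c i = (if i = 0 then P else if i = 1 then P' else P'')" for i
  have "\<forall>i\<le>2. primeideal (c i) R" "\<forall>i<2. c i \<subset> c (Suc i)"
    using assms \<open>P \<subset> P' \<and> P' \<subset> P''\<close> by (auto simp: c_def)
  then have "enat 2 \<le> krull_dim R"
    unfolding krull_dim_def by (intro Sup_upper) blast
  then show False using assms(1) by (simp add: one_enat_def)
qed

lemma (in noetherian_ring) maximal_ideal_of_family:
  assumes "F \<noteq> {}" "\<And>I. I \<in> F \<Longrightarrow> ideal I R"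
  shows "\<exists>I\<in>F. \<forall>J\<in>F. I \<subseteq> J \<longrightarrow> J = I"
proof (rule subset_Zorn_nonempty[OF assms(1)])
  fix \<C> assume \<C>: "\<C> \<noteq> {}" "subset.chain F \<C>"
  then have "subset.chain {J. ideal J R} \<C>"
    using assms(2) by (auto simp: subset.chain_def)
  then have "\<Union>\<C> \<in> \<C>" using ideal_chain_is_trivial \<C>(1) by blast
  then show "\<Union>\<C> \<in> F" using \<C>(2) by (auto simp: subset.chain_def)
qed

lemma (in cring) ideal_sum_principal:
  assumes "ideal I R" "a \<in> carrier R"
  shows "ideal {p \<oplus> r \<otimes> a | p r. p \<in> I \<and> r \<in> carrier R} R"
proof -
  have "{p \<oplus> r \<otimes> a | p r. p \<in> I \<and> r \<in> carrier R} = I <+>\<^bsub>R\<^esub> PIdl a"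
    by (auto simp: set_add_def' cgenideal_def)
  then show ?thesis
    using add_ideals[OF assms(1) cgenideal_ideal[OF assms(2)]] by simp
qed

text \<open>If \<open>a\<close> and \<open>b\<close> lie outside \<open>P\<close>, then by
  maximality both P + R a and P + R b meet \<open>S\<close>. The product of the two elements of
  \<open>S\<close> lies in P + R a b, so \<open>a b\<close> cannot lie in \<open>P\<close>.\<close>

lemma (in cring) primeideal_of_disjoint:
  assumes P: "ideal P R" "P \<inter> S = {}" and S: "S \<subseteq> carrier R" "\<one> \<in> S"
    and mult: "\<And>x y. x \<in> S \<Longrightarrow> y \<in> S \<Longrightarrow> x \<otimes> y \<in> S"
    and max: "\<And>J. ideal J R \<Longrightarrow> J \<inter> S = {} \<Longrightarrow> P \<subseteq> J \<Longrightarrow> J = P"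
  shows "primeideal P R"
proof (rule primeidealI[OF P(1) cring_axioms])
  interpret P: ideal P R by fact
  show "carrier R \<noteq> P" using P(2) S by auto
  have meets: "\<exists>p\<in>P. \<exists>r\<in>carrier R. p \<oplus> r \<otimes> a \<in> S" if a: "a \<in> carrier R" "a \<notin> P" for a
  proof (rule ccontr)
    assume neg: "\<not> ?thesis"
    define J where "J = {p \<oplus> r \<otimes> a | p r. p \<in> P \<and> r \<in> carrier R}"
    have J: "ideal J R" unfolding J_def by (rule ideal_sum_principal[OF P(1) a(1)])
    have "J \<inter> S = {}" using neg by (auto simp: J_def)
    moreover have "P \<subseteq> J"
    proof
      fix x assume "x \<in> P"
      then have "x = x \<oplus> \<zero> \<otimes> a" using a P.Icarr by simp
      then show "x \<in> J" unfolding J_def using \<open>x \<in> P\<close> by blast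
    qed
    ultimately have "J = P" using max[OF J] by blast
    moreover have "a = \<zero> \<oplus> \<one> \<otimes> a" using a by simp
    then have "a \<in> J"
      unfolding J_def using additive_subgroup.zero_closed[OF P.additive_subgroup_axioms] by blast
    ultimately show False using a by simp
  qed
  fix a b assume ab: "a \<in> carrier R" "b \<in> carrier R" "a \<otimes> b \<in> P"
  show "a \<in> P \<or> b \<in> P"
  proof (rule ccontr)
    assume "\<not> ?thesis"
    then obtain p r p' r' where h: "p \<in> P" "r \<in> carrier R" "p \<oplus> r \<otimes> a \<in> S"
      "p' \<in> P" "r' \<in> carrier R" "p' \<oplus> r' \<otimes> b \<in> S"
      using meets ab by meson
    have pc: "p \<in> carrier R" "p' \<in> carrier R" using h P.Icarr by auto
    have "(p \<oplus> r \<otimes> a) \<otimes> (p' \<oplus> r' \<otimes> b)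
        = ((p' \<oplus> r' \<otimes> b) \<otimes> p \<oplus> (r \<otimes> a) \<otimes> p') \<oplus> (r \<otimes> r') \<otimes> (a \<otimes> b)"
    proof -
      define v where "v = p' \<oplus> r' \<otimes> b"
      have vc: "v \<in> carrier R" using pc h ab by (simp add: v_def)
      have "(p \<oplus> r \<otimes> a) \<otimes> v = v \<otimes> p \<oplus> (r \<otimes> a) \<otimes> v"
        using vc pc h ab by (simp add: l_distr m_comm[of p v])
      also have "(r \<otimes> a) \<otimes> v = (r \<otimes> a) \<otimes> p' \<oplus> (r \<otimes> r') \<otimes> (a \<otimes> b)"
        using pc h ab by (simp add: v_def r_distr m_ac)
      finally show ?thesis using vc pc h ab by (simp add: v_def a_assoc)
    qed
    moreover have "((p' \<oplus> r' \<otimes> b) \<otimes> p \<oplus> (r \<otimes> a) \<otimes> p') \<oplus> (r \<otimes> r') \<otimes> (a \<otimes> b) \<in> P"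
      using h ab pc P.I_l_closed by (intro additive_subgroup.a_closed[OF P.additive_subgroup_axioms]) auto
    ultimately show False using mult[OF h(3,6)] P(2) by auto
  qed
qed

text \<open>A smaller prime is built inside \<open>I\<close> directly: an ideal maximal among those
  disjoint from the products of an element outside \<open>I\<close> and a power of \<open>u\<close>.
  Such products are nonzero because \<open>u\<close> is a nonzerodivisor. The resulting prime lies
  in \<open>I\<close> and omits \<open>u\<close>, so if \<open>I\<close> were not maximal there
  would be a chain of three primes.\<close>

lemma (in noetherian_ring) prime_with_nonzerodivisor_maximal:
  assumes R: "local_ring R" and dim: "krull_dim R = 1" and I: "primeideal I R"
    and u: "u \<in> I" "u \<in> non_zerodivisors R"
  shows "I = max_ideal R"
proof (rule ccontr)
  assume neq: "I \<noteq> max_ideal R"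
  interpret cring R using R by (simp add: local_ring_def)
  interpret I: primeideal I R by fact
  have one: "\<one> \<notin> I" using I.one_imp_carrier I.I_notcarr by auto
  have uc: "u \<in> carrier R" using u I.Icarr by blast
  have u0: "a = \<zero>" if "u \<otimes> a = \<zero>" "a \<in> carrier R" for a
    using u(2) that by (auto simp: non_zerodivisors_def)
  have uk0: "a = \<zero>" if "u [^] (k::nat) \<otimes> a = \<zero>" "a \<in> carrier R" for a k
    using that
  proof (induction k arbitrary: a)
    case (Suc k)
    have "u [^] k \<otimes> (u \<otimes> a) = \<zero>" using Suc.prems uc by (simp add: m_assoc)
    then have "u \<otimes> a = \<zero>" using Suc.IH[of "u \<otimes> a"] Suc.prems(2) uc by simp
    then show ?case using u0 Suc.prems(2) by blast
  qed simp
  define S where "S = {v \<otimes> u [^] k | v (k::nat). v \<in> carrier R \<and> v \<notin> I}"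
  have S: "S \<subseteq> carrier R" using uc by (auto simp: S_def)
  have S_notin: "x \<in> S" if "x \<in> carrier R" "x \<notin> I" for x
  proof -
    have "x = x \<otimes> u [^] (0::nat)" using that by simp
    then show ?thesis unfolding S_def using that by blast
  qed
  have "\<zero> \<notin> S"
  proof
    assume "\<zero> \<in> S"
    then obtain v and k :: nat where v: "v \<in> carrier R" "v \<notin> I" "v \<otimes> u [^] k = \<zero>"
      by (auto simp: S_def)
    then have "v = \<zero>" using uk0[of k v] uc by (simp add: m_comm)
    then show False using v additive_subgroup.zero_closed[OF I.additive_subgroup_axioms] by simp
  qed
  have S_mult: "x \<otimes> y \<in> S" if xy: "x \<in> S" "y \<in> S" for x y
  proof -
    obtain v w and k l :: nat where h: "x = v \<otimes> u [^] k" "y = w \<otimes> u [^] l"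
      "v \<in> carrier R" "v \<notin> I" "w \<in> carrier R" "w \<notin> I"
      using xy by (auto simp: S_def)
    have uu: "u [^] k \<in> carrier R" "u [^] l \<in> carrier R" using uc by simp_all
    have "x \<otimes> y = (v \<otimes> w) \<otimes> (u [^] k \<otimes> u [^] l)"
      using h uu by (simp add: m_ac)
    also have "\<dots> = (v \<otimes> w) \<otimes> u [^] (k + l)" using uc by (simp add: nat_pow_mult)
    finally show ?thesis using h I.I_prime[of v w] unfolding S_def by blast
  qed
  define F where "F = {J. ideal J R \<and> J \<inter> S = {}}"
  have "\<exists>P\<in>F. \<forall>J\<in>F. P \<subseteq> J \<longrightarrow> J = P"
  proof (rule maximal_ideal_of_family)
    have "{\<zero>} \<in> F" using zeroideal \<open>\<zero> \<notin> S\<close> by (simp add: F_def)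
    then show "F \<noteq> {}" by blast
  qed (simp add: F_def)
  then obtain P where P: "P \<in> F" and P_max: "\<And>J. J \<in> F \<Longrightarrow> P \<subseteq> J \<Longrightarrow> J = P" by blast
  have "primeideal P R"
    by (rule primeideal_of_disjoint[of P S])
      (use P P_max S S_mult S_notin[OF one_closed one] in \<open>auto simp: F_def\<close>)
  moreover have "P \<subset> I"
  proof -
    have "P \<subseteq> I" using P S_notin by (auto simp: F_def dest: ideal.Icarr)
    moreover have "u \<in> S"
    proof -
      have "u = \<one> \<otimes> u [^] (1::nat)" using uc by simp
      then show ?thesis unfolding S_def using one by blast
    qed
    then have "u \<notin> P" using P by (auto simp: F_def)
    ultimately show ?thesis using u by blast
  qed
  moreover have "I \<subset> max_ideal R"
    using local_ring_ideal_subset[OF R I.is_ideal one] neq by blast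
  moreover have "primeideal (max_ideal R) R"
    by (rule maximalideal_prime[OF local_ring_maximalideal[OF R]])
  ultimately show False using krull_dim_one_chain[OF dim _ I] by blast
qed

section \<open>Duality with respect to C\<close>

text \<open>Ideals of \<open>A\<close> and submodules over \<open>A\<close> or over \<open>B\<close>
  are all treated as plain subsets of the same \<open>Q\<close>, with a varying set of scalars.
  Closure under negation is recovered from the scalar -1 when the scalars form a subring.\<close>

definition scalar_closed :: "('a, 'n) ring_scheme \<Rightarrow> 'a set \<Rightarrow> 'a set \<Rightarrow> bool" where
  "scalar_closed Q A V \<longleftrightarrow> V \<subseteq> carrier Q \<and> \<zero>\<^bsub>Q\<^esub> \<in> V \<and>
     (\<forall>x\<in>V. \<forall>y\<in>V. x \<oplus>\<^bsub>Q\<^esub> y \<in> V) \<and> (\<forall>a\<in>A. \<forall>x\<in>V. a \<otimes>\<^bsub>Q\<^esub> x \<in> V)"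

lemma scalar_closedD:
  assumes "scalar_closed Q A V"
  shows "V \<subseteq> carrier Q" "\<zero>\<^bsub>Q\<^esub> \<in> V"
    "\<And>x y. x \<in> V \<Longrightarrow> y \<in> V \<Longrightarrow> x \<oplus>\<^bsub>Q\<^esub> y \<in> V"
    "\<And>a x. a \<in> A \<Longrightarrow> x \<in> V \<Longrightarrow> a \<otimes>\<^bsub>Q\<^esub> x \<in> V"
  using assms unfolding scalar_closed_def by auto

lemma scalar_closed_mono:
  "scalar_closed Q B V \<Longrightarrow> A \<subseteq> B \<Longrightarrow> scalar_closed Q A V"
  unfolding scalar_closed_def by blast

lemma (in cring) scalar_closed_minus:
  assumes "subring A R" "scalar_closed R A V" "x \<in> V" "y \<in> V"
  shows "x \<ominus> y \<in> V"
proof -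
  have "\<ominus> \<one> \<in> A"
    using subringE(3,5)[OF assms(1)] by blast
  moreover have c: "x \<in> carrier R" "y \<in> carrier R"
    using assms scalar_closedD(1) by blast+
  ultimately have "x \<ominus> y = x \<oplus> (\<ominus> \<one>) \<otimes> y"
    by (simp add: minus_eq l_minus)
  then show ?thesis
    using scalar_closedD(3,4)[OF assms(2)] \<open>\<ominus> \<one> \<in> A\<close> assms(3,4) by simp
qed

lemma (in cring) scalar_closed_uminus:
  assumes "subring A R" "scalar_closed R A V" "x \<in> V"
  shows "\<ominus> x \<in> V"
proof -
  have "\<zero> \<ominus> x \<in> V"
    using scalar_closed_minus[OF assms(1,2) _ assms(3)] scalar_closedD(2)[OF assms(2)] by blast
  moreover have "x \<in> carrier R" using assms scalar_closedD(1) by blast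
  ultimately show ?thesis by (simp add: minus_eq)
qed

lemma (in cring) scalar_closed_adjoin:
  assumes "subring A R" "scalar_closed R A V" "y \<in> carrier R"
  shows "scalar_closed R A {x \<oplus> r \<otimes> y | x r. x \<in> V \<and> r \<in> A}" (is "scalar_closed R A ?Y")
    and "V \<subseteq> {x \<oplus> r \<otimes> y | x r. x \<in> V \<and> r \<in> A}"
    and "y \<in> {x \<oplus> r \<otimes> y | x r. x \<in> V \<and> r \<in> A}"
proof -
  note sA = subringE[OF assms(1)] and sV = scalar_closedD[OF assms(2)]
  have cA: "a \<in> carrier R" if "a \<in> A" for a using sA(1) that by blast
  have cV: "x \<in> carrier R" if "x \<in> V" for x using sV(1) that by blast
  show *: "V \<subseteq> ?Y"
  proof
    fix x assume "x \<in> V"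
    then have "x = x \<oplus> \<zero> \<otimes> y" using cV assms(3) by simp
    then show "x \<in> ?Y" using \<open>x \<in> V\<close> sA(2) by blast
  qed
  have "y = \<zero> \<oplus> \<one> \<otimes> y" using assms(3) by simp
  then show "y \<in> ?Y" using sA(3) sV(2) by blast
  show "scalar_closed R A ?Y"
    unfolding scalar_closed_def
  proof (intro conjI ballI)
    show "?Y \<subseteq> carrier R" using cA cV assms(3) by auto
    show "\<zero> \<in> ?Y" using * sV(2) by blast
  next
    fix u v assume "u \<in> ?Y" "v \<in> ?Y"
    then obtain x r x' r' where h: "u = x \<oplus> r \<otimes> y" "v = x' \<oplus> r' \<otimes> y"
      "x \<in> V" "r \<in> A" "x' \<in> V" "r' \<in> A" by blast
    have "u \<oplus> v = (x \<oplus> x') \<oplus> (r \<oplus> r') \<otimes> y"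
      using h cA cV assms(3) by (simp add: l_distr a_ac)
    then show "u \<oplus> v \<in> ?Y" using h sV(3) sA(7) by blast
  next
    fix a u assume "a \<in> A" "u \<in> ?Y"
    then obtain x r where h: "u = x \<oplus> r \<otimes> y" "x \<in> V" "r \<in> A" by blast
    have "a \<otimes> u = a \<otimes> x \<oplus> (a \<otimes> r) \<otimes> y"
      using h cA cV assms(3) \<open>a \<in> A\<close> by (simp add: r_distr m_assoc)
    then show "a \<otimes> u \<in> ?Y" using h sV(4) sA(6) \<open>a \<in> A\<close> by blast
  qed
qed

lemma (in cring) minus_distr:
  assumes "x \<in> carrier R" "y \<in> carrier R" "z \<in> carrier R"
  shows "(x \<ominus> y) \<otimes> z = x \<otimes> z \<ominus> y \<otimes> z" "z \<otimes> (x \<ominus> y) = z \<otimes> x \<ominus> z \<otimes> y"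
  using assms by (simp_all add: minus_eq l_distr r_distr l_minus r_minus)

text \<open>Here \<open>A\<close> plays the role of \<open>R\<close>, \<open>M\<close> of its maximal ideal and \<open>B\<close> of \<open>R\<close>-bar, all inside \<open>Q\<close>.
  The assumption \<open>type1\<close>, that \<open>(C : M)/C\<close> has dimension at most one, is all that is used of the
  canonical module.\<close>

locale fractional_setting = cring Q for Q :: "('a, 'n) ring_scheme" (structure) +
  fixes A M B C :: "'a set" and s :: 'a
  assumes subring_A: "subring A Q"
    and subring_B: "subring B Q"
    and M_sub: "M \<subseteq> A" and zero_M: "\<zero> \<in> M" and one_M: "\<one> \<notin> M"
    and A_noetherian: "\<And>F. F \<noteq> {} \<Longrightarrow> (\<And>V. V \<in> F \<Longrightarrow> scalar_closed Q A V \<and> V \<subseteq> A) \<Longrightarrow>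
          \<exists>V\<in>F. \<forall>Y\<in>F. V \<subseteq> Y \<longrightarrow> Y = V"
    and A_dim1: "\<And>I u. scalar_closed Q A I \<Longrightarrow> I \<subseteq> A \<Longrightarrow> \<one> \<notin> I \<Longrightarrow>
          (\<And>a b. a \<in> A \<Longrightarrow> b \<in> A \<Longrightarrow> a \<otimes> b \<in> I \<Longrightarrow> a \<in> I \<or> b \<in> I) \<Longrightarrow>
          u \<in> I \<Longrightarrow> u \<in> Units Q \<Longrightarrow> I = M"
    and s_A: "s \<in> A" and s_unit: "s \<in> Units Q" and s_B: "\<And>b. b \<in> B \<Longrightarrow> s \<otimes> b \<in> A"
    and B_closure: "\<And>x p. x \<in> carrier Q \<Longrightarrow> set p \<subseteq> A \<Longrightarrow> eval (\<one> # p) x = \<zero> \<Longrightarrow> x \<in> B"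
    and B_local: "\<And>x y. x \<in> B \<Longrightarrow> y \<in> B \<Longrightarrow> (\<exists>z\<in>B. (x \<oplus> y) \<otimes> z = \<one>) \<Longrightarrow>
          (\<exists>z\<in>B. x \<otimes> z = \<one>) \<or> (\<exists>z\<in>B. y \<otimes> z = \<one>)"
    and A_C: "A \<subseteq> C" and C_B: "C \<subseteq> B" and C_sub: "scalar_closed Q A C"
    and type1: "\<And>z z'. z \<in> colon Q C M \<Longrightarrow> z' \<in> colon Q C M \<Longrightarrow> z' \<notin> C \<Longrightarrow>
          \<exists>r\<in>A. z \<ominus> r \<otimes> z' \<in> C"
begin

lemmas sA = subringE[OF subring_A]
lemmas sB = subringE[OF subring_B]
lemmas sC = scalar_closedD[OF C_sub]

lemma in_carrier:
  "a \<in> A \<Longrightarrow> a \<in> carrier Q" "a \<in> M \<Longrightarrow> a \<in> carrier Q" "a \<in> B \<Longrightarrow> a \<in> carrier Q"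
  "a \<in> C \<Longrightarrow> a \<in> carrier Q"
  using sA(1) M_sub sB(1) sC(1) by blast+

lemma A_sub_B: "A \<subseteq> B"
  using A_C C_B by blast

lemma s_carrier: "s \<in> carrier Q"
  using s_A in_carrier by blast

lemma scalar_closed_A: "scalar_closed Q A A"
  using sA(1,2,6,7) by (simp add: scalar_closed_def)

lemma scalar_closed_B: "scalar_closed Q B B"
  using sB(1,2,6,7) by (simp add: scalar_closed_def)

lemma colon_scalar_closed:
  assumes "scalar_closed Q A C'" "V \<subseteq> carrier Q"
  shows "scalar_closed Q A (colon Q C' V)"
  unfolding scalar_closed_def
proof (intro conjI ballI)
  note s' = scalar_closedD[OF assms(1)]
  show "colon Q C' V \<subseteq> carrier Q" by (auto simp: colon_def)
  show "\<zero> \<in> colon Q C' V" using s'(2) assms(2) by (auto simp: colon_def)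
  show "x \<oplus> y \<in> colon Q C' V" if "x \<in> colon Q C' V" "y \<in> colon Q C' V" for x y
    using that s'(3) assms(2) by (auto simp: colon_def l_distr subset_iff)
  show "a \<otimes> x \<in> colon Q C' V" if "a \<in> A" "x \<in> colon Q C' V" for a x
    using that s'(4) assms(2) in_carrier by (auto simp: colon_def m_assoc subset_iff)
qed

section \<open>Maximal submodules and socle elements\<close>

text \<open>Multiplication by the unit \<open>s \<otimes> u\<close> is injective and moves every
  member of the family into \<open>A\<close>: first \<open>u\<close> carries it into
  \<open>B\<close>, then \<open>s\<close> carries \<open>B\<close> into \<open>A\<close>. There the
  Noetherian property applies.\<close>

lemma maximal_submodule:
  assumes "F \<noteq> {}" "\<And>V. V \<in> F \<Longrightarrow> scalar_closed Q A V" "u \<in> Units Q"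
    "\<And>V x. V \<in> F \<Longrightarrow> x \<in> V \<Longrightarrow> u \<otimes> x \<in> B"
  shows "\<exists>V\<in>F. \<forall>Y\<in>F. V \<subseteq> Y \<longrightarrow> Y = V"
proof -
  define t where "t = s \<otimes> u"
  have t: "t \<in> Units Q" "t \<in> carrier Q" "u \<in> carrier Q"
    using assms(3) s_unit by (auto simp: t_def)
  have inj: "V = Y" if "V \<in> F" "Y \<in> F" "(\<otimes>) t ` V = (\<otimes>) t ` Y" for V Y
  proof -
    have "inj_on ((\<otimes>) t) (carrier Q)"
      using t by (auto simp: inj_on_def)
    moreover have "V \<subseteq> carrier Q" "Y \<subseteq> carrier Q"
      using that assms(2) scalar_closedD(1) by blast+
    ultimately show ?thesis
      using that(3) by (meson inj_on_image_eq_iff)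
  qed
  have "\<exists>V\<in>(\<lambda>V. (\<otimes>) t ` V) ` F. \<forall>Y\<in>(\<lambda>V. (\<otimes>) t ` V) ` F. V \<subseteq> Y \<longrightarrow> Y = V"
  proof (rule A_noetherian)
    show "(\<lambda>V. (\<otimes>) t ` V) ` F \<noteq> {}" using assms(1) by blast
  next
    fix V assume "V \<in> (\<lambda>V. (\<otimes>) t ` V) ` F"
    then obtain Y where Y: "Y \<in> F" "V = (\<otimes>) t ` Y" by blast
    note sY = scalar_closedD[OF assms(2)[OF Y(1)]]
    have cY: "y \<in> carrier Q" if "y \<in> Y" for y using sY(1) that by blast
    have "scalar_closed Q A V"
      unfolding scalar_closed_def
    proof (intro conjI ballI)
      show "V \<subseteq> carrier Q" using Y(2) cY t by auto
      have "\<zero> = t \<otimes> \<zero>" using t by simp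
      then show "\<zero> \<in> V" using Y(2) sY(2) by blast
    next
      fix x y assume "x \<in> V" "y \<in> V"
      then obtain v w where "x = t \<otimes> v" "y = t \<otimes> w" "v \<in> Y" "w \<in> Y" using Y(2) by blast
      moreover from this have "x \<oplus> y = t \<otimes> (v \<oplus> w)" using t cY by (simp add: r_distr)
      ultimately show "x \<oplus> y \<in> V" using Y(2) sY(3) by blast
    next
      fix a x assume "a \<in> A" "x \<in> V"
      then obtain v where "x = t \<otimes> v" "v \<in> Y" using Y(2) by blast
      moreover from this have "a \<otimes> x = t \<otimes> (a \<otimes> v)"
        using t cY in_carrier \<open>a \<in> A\<close> by (simp add: m_lcomm)
      ultimately show "a \<otimes> x \<in> V" using Y(2) sY(4) \<open>a \<in> A\<close> by blast
    qed
    moreover have "V \<subseteq> A"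
    proof
      fix x assume "x \<in> V"
      then obtain v where v: "x = t \<otimes> v" "v \<in> Y" using Y(2) by blast
      then have "x = s \<otimes> (u \<otimes> v)" using t cY s_carrier by (simp add: t_def m_assoc)
      then show "x \<in> A" using s_B assms(4)[OF Y(1) v(2)] by simp
    qed
    ultimately show "scalar_closed Q A V \<and> V \<subseteq> A" by blast
  qed
  then obtain V where V: "V \<in> F"
    "\<forall>Y\<in>F. (\<otimes>) t ` V \<subseteq> (\<otimes>) t ` Y \<longrightarrow> (\<otimes>) t ` Y = (\<otimes>) t ` V"
    by (auto simp only: bex_simps ball_simps image_iff)
  show ?thesis
  proof (intro bexI[OF _ V(1)] ballI impI)
    fix Y assume Y: "Y \<in> F" "V \<subseteq> Y"
    then have "(\<otimes>) t ` Y = (\<otimes>) t ` V" using V(2) by (simp add: image_mono)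
    then show "Y = V" using inj Y(1) V(1) by blast
  qed
qed

text \<open>Among the annihilators in \<open>A\<close> of the nonzero elements of Y/V, a maximal one
  is prime. It contains the unit \<open>u\<close> of \<open>Q\<close>, so by \<open>A_dim1\<close>
  it is \<open>M\<close>.\<close>

lemma socle_element:
  assumes "scalar_closed Q A V" "scalar_closed Q A Y" "V \<subseteq> Y" "V \<noteq> Y"
    "u \<in> A" "u \<in> Units Q" "\<And>y. y \<in> Y \<Longrightarrow> u \<otimes> y \<in> V"
  shows "\<exists>y\<in>Y - V. \<forall>m\<in>M. m \<otimes> y \<in> V"
proof -
  note sV = scalar_closedD[OF assms(1)] and sY = scalar_closedD[OF assms(2)]
  define ann where "ann y = {a \<in> A. a \<otimes> y \<in> V}" for y
  have cY: "y \<in> carrier Q" if "y \<in> Y" for y using sY(1) that by blast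
  have ann: "scalar_closed Q A (ann y) \<and> ann y \<subseteq> A" if "y \<in> Y" for y
    unfolding scalar_closed_def ann_def
    using sA(2,6,7) sV(2-4) in_carrier(1) cY[OF that] by (auto simp: l_distr m_assoc)
  have "\<exists>I\<in>ann ` (Y - V). \<forall>J\<in>ann ` (Y - V). I \<subseteq> J \<longrightarrow> J = I"
  proof (rule A_noetherian)
    show "ann ` (Y - V) \<noteq> {}" using assms(3,4) by blast
    show "scalar_closed Q A I \<and> I \<subseteq> A" if "I \<in> ann ` (Y - V)" for I
      using that ann by blast
  qed
  then obtain y where y: "y \<in> Y" "y \<notin> V"
    and y_max: "\<forall>J\<in>ann ` (Y - V). ann y \<subseteq> J \<longrightarrow> J = ann y"
    by (auto simp only: bex_simps)
  have "ann y = M"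
  proof (rule A_dim1[of _ u])
    show "scalar_closed Q A (ann y)" "ann y \<subseteq> A" using ann y by auto
    show "\<one> \<notin> ann y" using y cY by (simp add: ann_def)
    show "u \<in> ann y" "u \<in> Units Q" using assms y by (auto simp: ann_def)
  next
    fix a b assume ab: "a \<in> A" "b \<in> A" "a \<otimes> b \<in> ann y"
    show "a \<in> ann y \<or> b \<in> ann y"
    proof (rule disjCI)
      assume "b \<notin> ann y"
      then have bY: "b \<otimes> y \<notin> V" "b \<otimes> y \<in> Y" using ab y sY(4) by (auto simp: ann_def)
      have "ann y \<subseteq> ann (b \<otimes> y)"
      proof
        fix c assume "c \<in> ann y"
        then have "c \<in> A" "b \<otimes> (c \<otimes> y) \<in> V" using sV(4) ab by (auto simp: ann_def)
        then show "c \<in> ann (b \<otimes> y)"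
          using ab y cY in_carrier by (simp add: ann_def m_lcomm)
      qed
      then have "ann (b \<otimes> y) = ann y" using y_max bY by blast
      moreover have "a \<in> ann (b \<otimes> y)"
        using ab y(1) cY in_carrier by (simp add: ann_def m_assoc)
      ultimately show "a \<in> ann y" by simp
    qed
  qed
  then show ?thesis using y by (auto simp: ann_def)
qed

section \<open>Reflexivity with respect to \<open>C\<close>\<close>

abbreviation bidual :: "'a set \<Rightarrow> 'a set" where
  "bidual V \<equiv> colon Q C (colon Q C V)"

lemma colon_C_closed: "V \<subseteq> carrier Q \<Longrightarrow> scalar_closed Q A (colon Q C V)"
  using colon_scalar_closed[OF C_sub] .

lemma colonD: "x \<in> colon Q I J \<Longrightarrow> y \<in> J \<Longrightarrow> x \<otimes> y \<in> I" "x \<in> colon Q I J \<Longrightarrow> x \<in> carrier Q"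
  by (auto simp: colon_def)

lemma colonI: "x \<in> carrier Q \<Longrightarrow> (\<And>y. y \<in> J \<Longrightarrow> x \<otimes> y \<in> I) \<Longrightarrow> x \<in> colon Q I J"
  by (auto simp: colon_def)

text \<open>By \<open>type1\<close>, \<open>colon Q C V\<close> is \<open>colon Q C Y\<close> plus at most one further generator, and applying the
  same argument again, \<open>bidual Y\<close> is \<open>V\<close> plus at most one further generator, for which \<open>y\<close> can serve.\<close>

lemma bidual_adjoin:
  assumes "scalar_closed Q A V" "bidual V \<subseteq> V" "y \<in> carrier Q" "y \<notin> V"
    "\<And>m. m \<in> M \<Longrightarrow> m \<otimes> y \<in> V"
  defines "Y \<equiv> {x \<oplus> r \<otimes> y | x r. x \<in> V \<and> r \<in> A}"
  shows "bidual Y \<subseteq> Y"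
proof
  note sV = scalar_closedD[OF assms(1)]
  note Y = scalar_closed_adjoin[OF subring_A assms(1,3), folded Y_def]
  note sY = scalar_closedD[OF Y(1)]
  have cV: "x \<in> carrier Q" if "x \<in> V" for x using sV(1) that by blast
  \<comment> \<open>That \<open>y\<close> is outside \<open>bidual V\<close> is witnessed by
    \<open>z\<close>, which serves as the additional generator of \<open>colon Q C V\<close> over
    \<open>colon Q C Y\<close>.\<close>
  obtain z where z: "z \<in> colon Q C V" "z \<otimes> y \<notin> C"
  proof -
    have "y \<notin> bidual V" using assms(2,4) by blast
    then obtain z where "z \<in> colon Q C V" "y \<otimes> z \<notin> C" using assms(3) colonI by metis
    then show ?thesis using that assms(3) by (metis colonD(2) m_comm)
  qed
  have zc: "z \<in> carrier Q" using z colonD by blast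
  have yM: "z' \<otimes> y \<in> colon Q C M" if "z' \<in> colon Q C V" for z'
  proof (rule colonI)
    have zc': "z' \<in> carrier Q" using that colonD by blast
    then show "z' \<otimes> y \<in> carrier Q" using assms by simp
    fix m assume "m \<in> M"
    then have "z' \<otimes> (m \<otimes> y) \<in> C" using assms(5) that colonD by blast
    then show "z' \<otimes> y \<otimes> m \<in> C"
      using zc' in_carrier \<open>m \<in> M\<close> assms(3) by (simp add: m_ac)
  qed
  have mz: "m \<otimes> z \<in> colon Q C Y" if "m \<in> M" for m
  proof (rule colonI)
    have mc: "m \<in> carrier Q" "m \<in> A" using that M_sub in_carrier by auto
    then show "m \<otimes> z \<in> carrier Q" using zc by simp
    fix v assume "v \<in> Y"
    then obtain x r where v: "v = x \<oplus> r \<otimes> y" "x \<in> V" "r \<in> A" by (auto simp: Y_def)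
    have "m \<otimes> z \<otimes> v = m \<otimes> (z \<otimes> x) \<oplus> r \<otimes> (z \<otimes> (m \<otimes> y))"
      using mc zc v cV in_carrier assms(3) by (simp add: r_distr m_ac)
    moreover have "z \<otimes> x \<in> C" "z \<otimes> (m \<otimes> y) \<in> C"
      using v z(1) colonD assms(5) that by blast+
    ultimately show "m \<otimes> z \<otimes> v \<in> C" using sC mc v by simp
  qed
  fix w assume w: "w \<in> bidual Y"
  then have wc: "w \<in> carrier Q" using colonD by blast
  \<comment> \<open>By \<open>mz\<close> the products of \<open>M\<close> with \<open>z\<close> lie
    in \<open>colon Q C Y\<close>, which \<open>w\<close> multiplies into \<open>C\<close>. Thus
    \<open>type1\<close> can compare \<open>w \<otimes> z\<close> with \<open>z \<otimes> y\<close>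
    and yields the coefficient \<open>r\<close> of \<open>y\<close> in \<open>w\<close>.\<close>
  have "w \<otimes> z \<in> colon Q C M"
  proof (rule colonI)
    show "w \<otimes> z \<in> carrier Q" using wc zc by simp
    fix m assume "m \<in> M"
    then have "w \<otimes> (m \<otimes> z) \<in> C" using w mz colonD by blast
    then show "w \<otimes> z \<otimes> m \<in> C" using wc zc in_carrier \<open>m \<in> M\<close> by (simp add: m_ac)
  qed
  then obtain r where r: "r \<in> A" "w \<otimes> z \<ominus> r \<otimes> (z \<otimes> y) \<in> C"
    using type1 yM z by blast
  define v where "v = w \<ominus> r \<otimes> y"
  have rc: "r \<in> carrier Q" using r in_carrier by blast
  have vc: "v \<in> carrier Q" using wc rc assms(3) by (simp add: v_def)
  have vz: "v \<otimes> z \<in> C"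
  proof -
    have "v \<otimes> z = w \<otimes> z \<ominus> r \<otimes> (z \<otimes> y)"
      using wc rc zc assms(3) by (simp add: v_def minus_distr m_ac)
    then show ?thesis using r by simp
  qed
  have "v \<in> bidual V"
  proof (rule colonI)
    show "v \<in> carrier Q" by fact
    fix z' assume z': "z' \<in> colon Q C V"
    have zc': "z' \<in> carrier Q" using z' colonD by blast
    obtain r' where r': "r' \<in> A" "z' \<otimes> y \<ominus> r' \<otimes> (z \<otimes> y) \<in> C"
      using type1[OF yM[OF z'] yM[OF z(1)] z(2)] by blast
    have rc': "r' \<in> carrier Q" using r' in_carrier by blast
    \<comment> \<open>The correction makes \<open>q \<otimes> y\<close> an element of
      \<open>C\<close>, so \<open>q\<close> lies in \<open>colon Q C Y\<close> and \<open>w\<close>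
      multiplies it into \<open>C\<close>. The removed part \<open>r' \<otimes> z\<close> is handled
      by the choice of \<open>r\<close>, which put \<open>v \<otimes> z\<close> into
      \<open>C\<close>.\<close>
    define q where "q = z' \<ominus> r' \<otimes> z"
    have qc: "q \<in> carrier Q" using zc zc' rc' by (simp add: q_def)
    have qX: "q \<in> colon Q C V"
      unfolding q_def
      by (rule scalar_closed_minus[OF subring_A colon_C_closed[OF sV(1)] z'])
        (use scalar_closedD(4)[OF colon_C_closed[OF sV(1)]] r' z in blast)
    have "q \<otimes> y = z' \<otimes> y \<ominus> r' \<otimes> (z \<otimes> y)"
      using zc zc' rc' assms(3) by (simp add: q_def minus_distr m_ac)
    then have qy: "q \<otimes> y \<in> C" using r' by simp
    have "q \<in> colon Q C Y"
    proof (rule colonI)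
      show "q \<in> carrier Q" by fact
      fix c assume "c \<in> Y"
      then obtain x a where c: "c = x \<oplus> a \<otimes> y" "x \<in> V" "a \<in> A" by (auto simp: Y_def)
      have "q \<otimes> c = q \<otimes> x \<oplus> a \<otimes> (q \<otimes> y)"
        using qc c cV in_carrier assms(3) by (simp add: r_distr m_lcomm)
      then show "q \<otimes> c \<in> C" using c qX qy colonD sC by metis
    qed
    then have "w \<otimes> q \<in> C" using w colonD by blast
    moreover have "r \<otimes> (q \<otimes> y) \<in> C" using qy r sC by blast
    ultimately have "w \<otimes> q \<ominus> r \<otimes> (q \<otimes> y) \<in> C"
      using scalar_closed_minus[OF subring_A C_sub] by blast
    moreover have "v \<otimes> z' = (w \<otimes> q \<ominus> r \<otimes> (q \<otimes> y)) \<oplus> r' \<otimes> (v \<otimes> z)"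
    proof -
      have "z' = q \<oplus> r' \<otimes> z"
        using zc zc' rc' by (simp add: q_def minus_eq a_assoc l_neg)
      then have "v \<otimes> z' = v \<otimes> q \<oplus> r' \<otimes> (v \<otimes> z)"
        using vc qc rc' zc by (simp add: r_distr m_lcomm)
      moreover have "v \<otimes> q = w \<otimes> q \<ominus> r \<otimes> (q \<otimes> y)"
        using wc rc qc assms(3) by (simp add: v_def minus_distr m_ac)
      ultimately show ?thesis by simp
    qed
    ultimately show "v \<otimes> z' \<in> C" using sC r' vz by simp
  qed
  then have "v \<in> V" using assms(2) by blast
  moreover have "w = v \<oplus> r \<otimes> y"
    using wc rc assms(3) by (simp add: v_def minus_eq a_assoc l_neg)
  ultimately show "w \<in> Y" using r by (auto simp: Y_def)
qed

text \<open>A maximal reflexive submodule of \<open>Y\<close> above a copy of \<open>C\<close> must be \<open>Y\<close>, since otherwise a socle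
  element of the quotient could be adjoined.\<close>

lemma reflexive:
  assumes "scalar_closed Q A Y" "Y \<subseteq> B" "t \<in> Y" "t \<in> Units Q"
  shows "bidual Y \<subseteq> Y"
proof -
  note sY = scalar_closedD[OF assms(1)]
  \<comment> \<open>Since \<open>s\<close> multiplies \<open>C\<close> into \<open>A\<close>, the
    additional factor \<open>t\<close> puts the copy \<open>X0\<close> of \<open>C\<close> inside
    \<open>Y\<close>.\<close>
  define u where "u = t \<otimes> s"
  have tc: "t \<in> carrier Q" using assms by blast
  have u: "u \<in> Units Q" "u \<in> carrier Q" using assms s_unit by (auto simp: u_def)
  define X0 where "X0 = (\<otimes>) u ` C"
  have X0Y: "X0 \<subseteq> Y"
  proof
    fix x assume "x \<in> X0"
    then obtain c where c: "c \<in> C" "x = u \<otimes> c" by (auto simp: X0_def)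
    then have "x = (s \<otimes> c) \<otimes> t" using tc s_carrier in_carrier by (simp add: u_def m_ac)
    moreover have "s \<otimes> c \<in> A" using c C_B s_B by blast
    ultimately show "x \<in> Y" using sY(4) assms(3) by simp
  qed
  have X0: "scalar_closed Q A X0"
    unfolding scalar_closed_def
  proof (intro conjI ballI)
    show "X0 \<subseteq> carrier Q" using X0Y sY(1) by blast
    have "\<zero> = u \<otimes> \<zero>" using u by simp
    then show "\<zero> \<in> X0" using sC(2) by (auto simp: X0_def)
  next
    fix x y assume "x \<in> X0" "y \<in> X0"
    then obtain v w where "x = u \<otimes> v" "y = u \<otimes> w" "v \<in> C" "w \<in> C" by (auto simp: X0_def)
    moreover from this have "x \<oplus> y = u \<otimes> (v \<oplus> w)" using u in_carrier by (simp add: r_distr)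
    ultimately show "x \<oplus> y \<in> X0" using sC(3) by (auto simp: X0_def)
  next
    fix a x assume "a \<in> A" "x \<in> X0"
    then obtain v where "x = u \<otimes> v" "v \<in> C" by (auto simp: X0_def)
    moreover from this have "a \<otimes> x = u \<otimes> (a \<otimes> v)"
      using u in_carrier \<open>a \<in> A\<close> by (simp add: m_lcomm)
    ultimately show "a \<otimes> x \<in> X0" using sC(4) \<open>a \<in> A\<close> by (auto simp: X0_def)
  qed
  \<comment> \<open>Because \<open>X0\<close> is \<open>C\<close> scaled by the unit
    \<open>u\<close>, its dual contains \<open>inv u\<close>; testing \<open>w\<close> against this
    one element is enough.\<close>
  have X0b: "bidual X0 \<subseteq> X0"
  proof
    fix w assume w: "w \<in> bidual X0"
    then have wc: "w \<in> carrier Q" using colonD by blast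
    have "inv u \<in> colon Q C X0"
    proof (rule colonI)
      show "inv u \<in> carrier Q" using u by simp
      fix x assume "x \<in> X0"
      then obtain c where c: "c \<in> C" "x = u \<otimes> c" by (auto simp: X0_def)
      then have "inv u \<otimes> x = c" using u in_carrier by (simp add: m_assoc[symmetric])
      then show "inv u \<otimes> x \<in> C" using c by simp
    qed
    then have "w \<otimes> inv u \<in> C" using w colonD by blast
    moreover have "w = u \<otimes> (w \<otimes> inv u)" using u wc by (simp add: m_lcomm[of u w])
    ultimately show "w \<in> X0" by (auto simp: X0_def)
  qed
  define F where "F = {V. scalar_closed Q A V \<and> X0 \<subseteq> V \<and> V \<subseteq> Y \<and> bidual V \<subseteq> V}"
  have "\<exists>V\<in>F. \<forall>Z\<in>F. V \<subseteq> Z \<longrightarrow> Z = V"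
  proof (rule maximal_submodule[of _ \<one>])
    show "F \<noteq> {}" using X0 X0Y X0b by (auto simp: F_def)
    show "\<one> \<in> Units Q" by simp
    show "\<one> \<otimes> x \<in> B" if "V \<in> F" "x \<in> V" for V x
    proof -
      have "x \<in> B" using that assms(2) by (auto simp: F_def)
      then show ?thesis using in_carrier by simp
    qed
  qed (auto simp: F_def)
  then obtain V where "V \<in> F" and Xmax: "\<And>Z. Z \<in> F \<Longrightarrow> V \<subseteq> Z \<Longrightarrow> Z = V" by blast
  then have V: "scalar_closed Q A V" "X0 \<subseteq> V" "V \<subseteq> Y" "bidual V \<subseteq> V"
    by (auto simp: F_def)
  have "V = Y"
  proof (rule ccontr)
    assume "V \<noteq> Y"
    \<comment> \<open>One factor \<open>s\<close> multiplies \<open>Y\<close> into \<open>A\<close>,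
      hence into \<open>C\<close>, and the rest \<open>t \<otimes> s\<close> is \<open>u\<close>; so
      \<open>e\<close> multiplies \<open>Y\<close> into \<open>X0\<close>, which lies in
      \<open>V\<close>. The grouping shows that \<open>e\<close> itself is in
      \<open>A\<close>.\<close>
    define e where "e = s \<otimes> (s \<otimes> t)"
    have st: "s \<otimes> t \<in> A" using s_B assms by blast
    have "\<exists>y\<in>Y - V. \<forall>m\<in>M. m \<otimes> y \<in> V"
    proof (rule socle_element[OF V(1) assms(1) V(3) \<open>V \<noteq> Y\<close>])
      show "e \<in> A" using st s_A sA by (simp add: e_def)
      show "e \<in> Units Q" using s_unit assms(4) by (simp add: e_def)
      fix y assume y: "y \<in> Y"
      then have "s \<otimes> y \<in> C" using assms(2) s_B A_C by blast
      moreover have "e \<otimes> y = u \<otimes> (s \<otimes> y)"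
        using y sY(1) s_carrier tc by (auto simp: e_def u_def m_ac)
      ultimately show "e \<otimes> y \<in> V" using V(2) by (auto simp: X0_def)
    qed
    then obtain y where y: "y \<in> Y" "y \<notin> V" "\<And>m. m \<in> M \<Longrightarrow> m \<otimes> y \<in> V" by blast
    have yc: "y \<in> carrier Q" using y sY(1) by blast
    define Z where "Z = {x \<oplus> r \<otimes> y | x r. x \<in> V \<and> r \<in> A}"
    note Z = scalar_closed_adjoin[OF subring_A V(1) yc, folded Z_def]
    have "bidual Z \<subseteq> Z"
      unfolding Z_def by (rule bidual_adjoin[OF V(1,4) yc y(2,3)])
    moreover have "Z \<subseteq> Y"
      using V(3) y(1) sY(3,4) by (auto simp: Z_def)
    ultimately have "Z \<in> F" using Z V(2) by (auto simp: F_def)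
    then have "Z = V" using Xmax Z by blast
    then show False using Z y by blast
  qed
  then show ?thesis using V by simp
qed

text \<open>An element multiplying \<open>C\<close> into itself also multiplies
  \<open>colon Q C A\<close> into \<open>C\<close>, because \<open>colon Q C A\<close> is contained
  in \<open>C\<close>. Hence it lies in the bidual of \<open>A\<close>, which is \<open>A\<close> by
  reflexivity.\<close>

lemma colon_C_C: "colon Q C C = A"
proof
  show "A \<subseteq> colon Q C C" using sC(4) in_carrier by (auto intro: colonI)
  show "colon Q C C \<subseteq> A"
  proof
    fix z assume z: "z \<in> colon Q C C"
    have "z \<in> bidual A"
    proof (rule colonI)
      show "z \<in> carrier Q" using z colonD by blast
      fix c assume c: "c \<in> colon Q C A"
      then have "c \<otimes> \<one> \<in> C" using sA(3) colonD by blast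
      then have "c \<in> C" using c colonD(2) by fastforce
      then show "z \<otimes> c \<in> C" using z colonD by blast
    qed
    then show "z \<in> A"
      using reflexive[OF scalar_closed_A A_sub_B sA(3)] by auto
  qed
qed

section \<open>The conductor of \<open>A\<close> in \<open>B\<close>\<close>

abbreviation conductor :: "'a set" where "conductor \<equiv> colon Q A B"

text \<open>If \<open>z\<close> multiplies \<open>B\<close> into \<open>C\<close> and
  \<open>b\<close> is in \<open>B\<close>, then \<open>z b\<close> multiplies \<open>C\<close> into
  \<open>C\<close>, because \<open>b C\<close> stays in \<open>B\<close>; so \<open>z b\<close> is
  in \<open>A\<close> by \<open>colon_C_C\<close>.\<close>

lemma conductor_eq: "conductor = colon Q C B"
proof
  show "conductor \<subseteq> colon Q C B" using A_C by (auto simp: colon_def)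
  show "colon Q C B \<subseteq> conductor"
  proof
    fix z assume z: "z \<in> colon Q C B"
    then have zc: "z \<in> carrier Q" using colonD by blast
    show "z \<in> conductor"
    proof (rule colonI[OF zc])
      fix b assume b: "b \<in> B"
      have "z \<otimes> b \<in> colon Q C C"
      proof (rule colonI)
        show "z \<otimes> b \<in> carrier Q" using zc b in_carrier by simp
        fix c assume c: "c \<in> C"
        then have "b \<otimes> c \<in> B" using b C_B sB(6) by blast
        then have "z \<otimes> (b \<otimes> c) \<in> C" using z colonD by blast
        then show "z \<otimes> b \<otimes> c \<in> C" using zc b c in_carrier by (simp add: m_assoc)
      qed
      then show "z \<otimes> b \<in> A" using colon_C_C by simp
    qed
  qed
qed

lemma conductor_closed: "scalar_closed Q B conductor"
  unfolding scalar_closed_def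
proof (intro conjI ballI)
  note K = scalar_closedD[OF colon_scalar_closed[OF scalar_closed_A sB(1)]]
  show "conductor \<subseteq> carrier Q" "\<zero> \<in> conductor" using K by blast+
  show "x \<oplus> y \<in> conductor" if "x \<in> conductor" "y \<in> conductor" for x y using that K by blast
  show "b \<otimes> x \<in> conductor" if "b \<in> B" "x \<in> conductor" for b x
  proof (rule colonI)
    have c: "b \<in> carrier Q" "x \<in> carrier Q" using that in_carrier colonD by blast+
    then show "b \<otimes> x \<in> carrier Q" by simp
    fix y assume "y \<in> B"
    then have "x \<otimes> (b \<otimes> y) \<in> A" using that sB(6) colonD by blast
    then show "b \<otimes> x \<otimes> y \<in> A" using c \<open>y \<in> B\<close> in_carrier by (simp add: m_ac)
  qed
qed

lemma conductor_sub_A: "conductor \<subseteq> A"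
proof
  fix x assume x: "x \<in> conductor"
  then have "x \<otimes> \<one> \<in> A" using colonD sB(3) by blast
  then show "x \<in> A" using x colonD(2) by fastforce
qed

lemma s_conductor: "s \<in> conductor"
  using s_B s_carrier by (auto intro: colonI)

text \<open>The \<open>A\<close>-module generated by the powers of \<open>x\<close> with exponents
  below \<open>k\<close>, built one generator at a time so that \<open>scalar_closed_adjoin\<close>
  applies to each stage.\<close>

fun powers_span :: "'a \<Rightarrow> nat \<Rightarrow> 'a set" where
  "powers_span x 0 = {\<zero>}"
| "powers_span x (Suc k) = {y \<oplus> a \<otimes> x [^] k | y a. y \<in> powers_span x k \<and> a \<in> A}"

lemma powers_span_closed: "x \<in> carrier Q \<Longrightarrow> scalar_closed Q A (powers_span x k)"
proof (induction k)
  case 0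
  then show ?case using in_carrier by (auto simp: scalar_closed_def)
next
  case (Suc k)
  then show ?case using scalar_closed_adjoin(1)[OF subring_A, of "powers_span x k"] by simp
qed

text \<open>The coefficient list has length exactly \<open>k\<close>, so putting
  \<open>\<one>\<close> in front of it yields a monic polynomial of degree \<open>k\<close>.\<close>

lemma powers_span_eval:
  assumes "x \<in> carrier Q" "y \<in> powers_span x k"
  shows "\<exists>p. set p \<subseteq> A \<and> length p = k \<and> eval p x = y"
  using assms(2)
proof (induction k arbitrary: y)
  case 0
  then show ?case by auto
next
  case (Suc k)
  then obtain v a where v: "y = v \<oplus> a \<otimes> x [^] k" "v \<in> powers_span x k" "a \<in> A" by auto
  from Suc.IH[OF v(2)] obtain p where p: "set p \<subseteq> A" "length p = k" "eval p x = v" by blast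
  have "v \<in> carrier Q" using v(2) scalar_closedD(1)[OF powers_span_closed[OF assms(1)]] by blast
  then have "eval (a # p) x = y"
    using p v assms(1) in_carrier by (simp add: a_comm)
  then show ?case using p v by (intro exI[of _ "a # p"]) auto
qed

text \<open>The unit \<open>u\<close> multiplies all the modules \<open>powers_span x k\<close> into
  \<open>B\<close>, so this family has a maximal member and the ascending chain stops. Then some
  power of \<open>x\<close> is an \<open>A\<close>-combination of lower ones, which is an equation
  of integral dependence.\<close>

lemma completely_integrally_closed:
  assumes x: "x \<in> carrier Q" and u: "u \<in> Units Q" and ux: "\<And>k::nat. u \<otimes> x [^] k \<in> B"
  shows "x \<in> B"
proof -
  have uc: "u \<in> carrier Q" using u by blast
  have span: "u \<otimes> y \<in> B" if "y \<in> powers_span x k" for y k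
    using that
  proof (induction k arbitrary: y)
    case 0
    then show ?case using uc sB(2) by simp
  next
    case (Suc k)
    then obtain v a where v: "y = v \<oplus> a \<otimes> x [^] k" "v \<in> powers_span x k" "a \<in> A" by auto
    have vc: "v \<in> carrier Q" using v(2) scalar_closedD(1)[OF powers_span_closed[OF x]] by blast
    have "u \<otimes> y = u \<otimes> v \<oplus> a \<otimes> (u \<otimes> x [^] k)"
      using v vc x uc in_carrier by (simp add: r_distr m_lcomm)
    moreover have "a \<in> B" using v A_sub_B by blast
    ultimately show ?case using Suc.IH[OF v(2)] ux sB(6,7) by simp
  qed
  have "\<exists>V\<in>range (powers_span x). \<forall>Y\<in>range (powers_span x). V \<subseteq> Y \<longrightarrow> Y = V"
  proof (rule maximal_submodule[OF _ _ u])
    show "scalar_closed Q A V" if "V \<in> range (powers_span x)" for V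
      using that powers_span_closed[OF x] by blast
    show "u \<otimes> y \<in> B" if "V \<in> range (powers_span x)" "y \<in> V" for V y
      using that span by blast
  qed blast
  then obtain k where k: "\<forall>Y\<in>range (powers_span x). powers_span x k \<subseteq> Y \<longrightarrow> Y = powers_span x k"
    by (auto simp only: bex_simps)
  note adj = scalar_closed_adjoin[OF subring_A powers_span_closed[OF x, of k], of "x [^] k"]
  have xk: "x [^] k \<in> carrier Q" using x by simp
  have "powers_span x (Suc k) = powers_span x k"
    using bspec[OF k rangeI, of "Suc k"] adj(2)[OF xk] by simp
  then have "x [^] k \<in> powers_span x k" using adj(3)[OF xk] by simp
  then have "\<ominus> (x [^] k) \<in> powers_span x k"
    using scalar_closed_uminus[OF subring_A powers_span_closed[OF x]] by blast
  from powers_span_eval[OF x this] obtain p where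
    p: "set p \<subseteq> A" "length p = k" "eval p x = \<ominus> (x [^] k)" by blast
  have "eval (\<one> # p) x = \<zero>" using p x by (simp add: r_neg)
  then show ?thesis using B_closure x p by blast
qed

text \<open>Either the conductor \<open>K\<close> is \<open>B\<close>, or reflexivity of a maximal proper \<open>B\<close>-submodule \<open>K0\<close> of \<open>K\<close> gives
  \<open>x \<notin> B\<close> with \<open>x K0 \<subseteq> K\<close>. Such an \<open>x\<close> is the inverse of a uniformizer of \<open>B\<close>, and \<open>x\<^sup>l K = B\<close> for
  the last \<open>l\<close> with \<open>x\<^sup>l K \<subseteq> B\<close>.\<close>

lemma conductor_principal:
  "\<exists>c\<in>Units Q. conductor = {c \<otimes> b | b. b \<in> B}"
proof -
  let ?K = conductor
  note sK = scalar_closedD[OF conductor_closed]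
  have KB: "?K \<subseteq> B" using conductor_sub_A A_sub_B by blast
  \<comment> \<open>A generator of the conductor divides \<open>s\<close>, so it is automatically a
    unit of \<open>Q\<close>.\<close>
  have principalI: "\<exists>c\<in>Units Q. ?K = {c \<otimes> b | b. b \<in> B}"
    if c: "c \<in> ?K" and gen: "\<And>k. k \<in> ?K \<Longrightarrow> \<exists>b\<in>B. k = c \<otimes> b" for c
  proof (rule bexI)
    show "?K = {c \<otimes> b | b. b \<in> B}"
    proof (intro equalityI subsetI)
      fix k assume "k \<in> ?K"
      then show "k \<in> {c \<otimes> b | b. b \<in> B}" using gen by blast
    next
      fix k assume "k \<in> {c \<otimes> b | b. b \<in> B}"
      then obtain b where b: "b \<in> B" "k = c \<otimes> b" by blast
      then have "b \<otimes> c \<in> ?K" using c sK(4) by blast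
      moreover have "c \<in> carrier Q" "b \<in> carrier Q" using c b in_carrier sK(1) by blast+
      ultimately show "k \<in> ?K" using b by (simp add: m_comm)
    qed
    obtain b where b: "b \<in> B" "s = c \<otimes> b" using gen[OF s_conductor] by blast
    then have "c \<otimes> b \<in> Units Q" using s_unit by simp
    then show "c \<in> Units Q"
      using c b in_carrier sK(1) by (metis prod_unit_l unit_factor subsetD)
  qed
  define N where "N = {x \<in> B. \<not> (\<exists>z\<in>B. x \<otimes> z = \<one>)}"
  have NB: "N \<subseteq> B" by (auto simp: N_def)
  have N_mult: "x \<otimes> b \<in> N" if "x \<in> N" "b \<in> B" for x b
  proof -
    have c: "x \<in> carrier Q" "b \<in> carrier Q" using that NB in_carrier by blast+
    have "\<not> (\<exists>z\<in>B. (x \<otimes> b) \<otimes> z = \<one>)"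
    proof
      assume "\<exists>z\<in>B. (x \<otimes> b) \<otimes> z = \<one>"
      then obtain z where z: "z \<in> B" "(x \<otimes> b) \<otimes> z = \<one>" by blast
      then have "x \<otimes> (b \<otimes> z) = \<one>" "b \<otimes> z \<in> B"
        using c in_carrier sB(6) that by (auto simp: m_assoc)
      then show False using that(1) by (auto simp: N_def)
    qed
    then show ?thesis using that NB sB(6) by (auto simp: N_def)
  qed
  show ?thesis
  proof (cases "?K \<subseteq> N")
    \<comment> \<open>The conductor contains a unit of \<open>B\<close>, which generates it.\<close>
    case False
    then obtain v z where v: "v \<in> ?K" "z \<in> B" "v \<otimes> z = \<one>" using KB by (auto simp: N_def)
    have vc: "v \<in> carrier Q" "z \<in> carrier Q" using v in_carrier sK(1) by blast+
    show ?thesis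
    proof (rule principalI[OF v(1)])
      fix k assume k: "k \<in> ?K"
      then have kc: "k \<in> carrier Q" "k \<in> B" using sK(1) KB by blast+
      have "v \<otimes> (z \<otimes> k) = (v \<otimes> z) \<otimes> k" using vc kc by (simp add: m_assoc)
      then have "k = v \<otimes> (z \<otimes> k)" using v(3) kc by simp
      then show "\<exists>b\<in>B. k = v \<otimes> b" using v(2) kc sB(6) by blast
    qed
  next
    case KN: True
    define F where "F = {V. scalar_closed Q B V \<and> V \<subseteq> ?K \<and> V \<noteq> ?K}"
    have ne: "\<one> \<noteq> \<zero>" using one_M zero_M by metis
    have "s \<noteq> \<zero>"
    proof
      assume "s = \<zero>"
      then have "\<one> = \<zero>" using s_unit
        by (metis Units_inv_closed Units_r_inv l_null)
      then show False using ne by simp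
    qed
    then have "{\<zero>} \<in> F"
      using s_conductor sK(2) in_carrier by (auto simp: F_def scalar_closed_def)
    then have "\<exists>V\<in>F. \<forall>Z\<in>F. V \<subseteq> Z \<longrightarrow> Z = V"
    proof (intro maximal_submodule[of _ \<one>])
      show "\<one> \<otimes> x \<in> B" if "V \<in> F" "x \<in> V" for V x
      proof -
        have "x \<in> B" using that KB by (auto simp: F_def)
        then show ?thesis using in_carrier by simp
      qed
    qed (auto simp: F_def intro: scalar_closed_mono[OF _ A_sub_B])
    then obtain K0 where "K0 \<in> F" and K0max: "\<And>Z. Z \<in> F \<Longrightarrow> K0 \<subseteq> Z \<Longrightarrow> Z = K0" by blast
    then have K0: "scalar_closed Q B K0" "K0 \<subseteq> ?K" "K0 \<noteq> ?K" by (auto simp: F_def)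
    note sK0 = scalar_closedD[OF K0(1)]
    \<comment> \<open>This is Nakayama's argument. If \<open>y \<otimes> c\<close> were outside
      \<open>K0\<close>, maximality would give \<open>c = k + r y c\<close> with \<open>k\<close> in
      \<open>K0\<close>. By \<open>B_local\<close> the element \<open>1 - y r\<close> is a unit of
      \<open>B\<close>, since \<open>y r\<close> is not, and so \<open>c\<close> itself would lie in
      \<open>K0\<close>.\<close>
    have NK: "y \<otimes> c \<in> K0" if y: "y \<in> N" and c: "c \<in> ?K" for y c
    proof (rule ccontr)
      assume nin: "y \<otimes> c \<notin> K0"
      have yB: "y \<in> B" using y NB by blast
      have cc: "y \<in> carrier Q" "c \<in> carrier Q" using yB c in_carrier sK(1) by blast+
      define Z where "Z = {k \<oplus> r \<otimes> (y \<otimes> c) | k r. k \<in> K0 \<and> r \<in> B}"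
      have ycc: "y \<otimes> c \<in> carrier Q" using cc by simp
      note Z = scalar_closed_adjoin[OF subring_B K0(1) ycc, folded Z_def]
      have "Z \<subseteq> ?K"
        using K0(2) sK(3,4) yB c by (auto simp: Z_def)
      moreover have "Z \<noteq> K0" using Z(3) nin by blast
      ultimately have "Z = ?K" using K0max[of Z] Z by (auto simp: F_def)
      then obtain k r where k: "c = k \<oplus> r \<otimes> (y \<otimes> c)" "k \<in> K0" "r \<in> B"
        using c(1) unfolding Z_def by blast
      have kc: "k \<in> carrier Q" "r \<in> carrier Q" using k sK0(1) in_carrier by blast+
      define e where "e = \<one> \<ominus> y \<otimes> r"
      have yr: "y \<otimes> r \<in> N" using N_mult y k by blast
      then have yrB: "y \<otimes> r \<in> B" using NB by blast
      have eB: "e \<in> B" using scalar_closed_minus[OF subring_B scalar_closed_B sB(3) yrB]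
        by (simp add: e_def)
      have ec: "e \<in> carrier Q" using eB in_carrier by blast
      have "e \<oplus> y \<otimes> r = \<one>" using cc kc by (simp add: e_def minus_eq a_assoc l_neg)
      then have "\<exists>z\<in>B. (e \<oplus> y \<otimes> r) \<otimes> z = \<one>" using sB(3) by force
      then have "\<exists>z\<in>B. e \<otimes> z = \<one>"
        using B_local[OF eB yrB] yr by (auto simp: N_def)
      then obtain z where z: "z \<in> B" "e \<otimes> z = \<one>" by blast
      have zc: "z \<in> carrier Q" using z in_carrier by blast
      have "c \<otimes> e = c \<ominus> r \<otimes> (y \<otimes> c)"
        using cc kc by (simp add: e_def minus_distr m_ac)
      also have "\<dots> = (k \<oplus> r \<otimes> (y \<otimes> c)) \<ominus> r \<otimes> (y \<otimes> c)" using k(1) by simp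
      also have "\<dots> = k" using cc kc by (simp add: minus_eq a_assoc r_neg)
      finally have ce: "c \<otimes> e = k" .
      have "c = c \<otimes> (e \<otimes> z)" using z cc by simp
      also have "\<dots> = z \<otimes> (c \<otimes> e)" using cc ec zc by (simp add: m_ac)
      finally have "c \<in> K0" using ce k z sK0(4) by simp
      then show False using nin sK0(4) yB by blast
    qed
    obtain c where c: "c \<in> ?K" "c \<notin> K0" using K0 by blast
    have cc: "c \<in> carrier Q" using c sK(1) by blast
    \<comment> \<open>Reflexivity needs a unit of \<open>Q\<close> inside \<open>K0\<close>. The
      element \<open>s\<close> is in the conductor and, in this case, also in \<open>N\<close>, so
      \<open>NK\<close> provides its square.\<close>
    have "s \<otimes> s \<in> K0" using NK s_conductor KN by blast
    then have "bidual K0 \<subseteq> K0"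
      using reflexive[of K0 "s \<otimes> s"] K0 KB scalar_closed_mono[OF K0(1) A_sub_B] s_unit by auto
    then have "c \<notin> bidual K0" using c by blast
    then obtain x where x: "x \<in> colon Q C K0" "c \<otimes> x \<notin> C"
      using cc colonI by metis
    have xc: "x \<in> carrier Q" using x colonD by blast
    have xK0: "x \<otimes> k \<in> ?K" if k: "k \<in> K0" for k
      unfolding conductor_eq
    proof (rule colonI)
      have kc: "k \<in> carrier Q" using k sK0(1) by blast
      then show "x \<otimes> k \<in> carrier Q" using xc by simp
      fix b assume b: "b \<in> B"
      then have "x \<otimes> (b \<otimes> k) \<in> C" using x(1) sK0(4) k colonD by blast
      then show "x \<otimes> k \<otimes> b \<in> C" using xc kc b in_carrier by (simp add: m_ac)
    qed
    have xB: "x \<notin> B"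
    proof
      assume "x \<in> B"
      then have "x \<otimes> c \<in> ?K" using sK(4) c by blast
      then have "x \<otimes> c \<in> C" using conductor_sub_A A_C by blast
      then show False using x(2) xc cc by (simp add: m_comm)
    qed
    \<comment> \<open>Multiplication by \<open>x \<otimes> y\<close> maps the conductor to itself:
      \<open>y\<close> takes it into \<open>K0\<close> and \<open>x\<close> takes \<open>K0\<close>
      back. Thus \<open>s\<close> times every power of \<open>x \<otimes> y\<close> stays in
      \<open>B\<close>.\<close>
    have xN: "x \<otimes> y \<in> B" if y: "y \<in> N" for y
    proof (rule completely_integrally_closed[OF _ s_unit])
      have yc: "y \<in> carrier Q" using y NB in_carrier by blast
      show xyc: "x \<otimes> y \<in> carrier Q" using xc yc by simp
      fix k :: nat
      have "s \<otimes> (x \<otimes> y) [^] k \<in> ?K"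
      proof (induction k)
        case 0
        then show ?case using s_conductor s_carrier by simp
      next
        case (Suc k)
        let ?w = "s \<otimes> (x \<otimes> y) [^] k"
        have "x \<otimes> (y \<otimes> ?w) \<in> ?K" using NK[OF y Suc] xK0 by blast
        moreover have "s \<otimes> (x \<otimes> y) [^] Suc k = x \<otimes> (y \<otimes> ?w)"
        proof -
          have g: "(x \<otimes> y) [^] k \<in> carrier Q" using xyc by simp
          show ?thesis unfolding nat_pow_Suc using xc yc s_carrier g by (simp add: m_ac)
        qed
        ultimately show ?case by simp
      qed
      then show "s \<otimes> (x \<otimes> y) [^] k \<in> B" using KB by blast
    qed
    have pow_Suc: "w \<otimes> x [^] Suc k = x \<otimes> (w \<otimes> x [^] k)" if "w \<in> carrier Q" for w and k :: nat
    proof -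
      have g: "x [^] k \<in> carrier Q" using xc by simp
      show ?thesis unfolding nat_pow_Suc using xc that g by (simp add: m_ac)
    qed
    \<comment> \<open>If \<open>x\<close> preserved \<open>N\<close>, then \<open>s\<close> times
      every power of \<open>x\<close> would lie in \<open>B\<close>, forcing \<open>x\<close> into
      \<open>B\<close>. So some \<open>x \<otimes> y\<close> is a unit of \<open>B\<close>, and
      \<open>x\<close> is a unit of \<open>Q\<close>.\<close>
    have "\<exists>y\<in>N. x \<otimes> y \<notin> N"
    proof (rule ccontr)
      assume "\<not> (\<exists>y\<in>N. x \<otimes> y \<notin> N)"
      then have *: "x \<otimes> y \<in> N" if "y \<in> N" for y using that by blast
      have "s \<otimes> x [^] k \<in> N" for k :: nat
      proof (induction k)
        case 0
        then show ?case using s_conductor KN s_carrier by auto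
      next
        case (Suc k)
        then show ?case using * pow_Suc[OF s_carrier] by simp
      qed
      then have "x \<in> B" using completely_integrally_closed[OF xc s_unit] NB by blast
      then show False using xB by simp
    qed
    then obtain y where y: "y \<in> N" "x \<otimes> y \<notin> N" by blast
    obtain z where z: "z \<in> B" "(x \<otimes> y) \<otimes> z = \<one>" using y xN by (auto simp: N_def)
    have yzc: "y \<in> carrier Q" "z \<in> carrier Q" using y z NB in_carrier by blast+
    have "x \<otimes> (y \<otimes> z) = \<one>" using z xc yzc by (simp add: m_assoc)
    then have xu: "x \<in> Units Q" using xc yzc
      by (metis m_closed one_closed Units_one_closed unit_factor)
    \<comment> \<open>The first exponent that takes the conductor out of \<open>B\<close> exists
      because \<open>x\<close> is not in \<open>B\<close>, and it is not zero; \<open>l\<close> is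
      its predecessor.\<close>
    have "\<exists>k::nat. \<exists>c\<in>?K. c \<otimes> x [^] k \<notin> B"
      using completely_integrally_closed[OF xc s_unit] xB s_conductor by blast
    then obtain k :: nat where k: "\<exists>c\<in>?K. c \<otimes> x [^] k \<notin> B"
      "\<And>l. l < k \<Longrightarrow> \<not> (\<exists>c\<in>?K. c \<otimes> x [^] l \<notin> B)"
      using exists_least_iff[of "\<lambda>k::nat. \<exists>c\<in>?K. c \<otimes> x [^] k \<notin> B"] by blast
    have "k \<noteq> 0"
    proof
      assume "k = 0"
      then obtain c where c: "c \<in> ?K" "c \<otimes> x [^] (0::nat) \<notin> B" using k(1) by blast
      then have "c \<in> B" "c \<in> carrier Q" using KB in_carrier by blast+
      then show False using c by simp
    qed
    then obtain l where l: "k = Suc l" using not0_implies_Suc by blast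
    have lB: "c \<otimes> x [^] l \<in> B" if "c \<in> ?K" for c using k(2)[of l] l that by auto
    obtain d where d: "d \<in> ?K" "d \<otimes> x [^] k \<notin> B" using k by blast
    have dc: "d \<in> carrier Q" using d sK(1) by blast
    \<comment> \<open>Otherwise one more factor \<open>x\<close> would keep
      \<open>d \<otimes> x [^] l\<close> in \<open>B\<close> by \<open>xN\<close>, against the
      choice of \<open>d\<close>. As a unit of \<open>B\<close> up to the power of \<open>x\<close>,
      this \<open>d\<close> generates the conductor.\<close>
    have "d \<otimes> x [^] l \<notin> N"
    proof
      assume "d \<otimes> x [^] l \<in> N"
      then have "x \<otimes> (d \<otimes> x [^] l) \<in> B" using xN by blast
      then show False using d l pow_Suc[OF dc] by simp
    qed
    then obtain v where v: "v \<in> B" "(d \<otimes> x [^] l) \<otimes> v = \<one>"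
      using lB[OF d(1)] by (auto simp: N_def)
    show ?thesis
    proof (rule principalI[OF d(1)])
      fix e assume e: "e \<in> ?K"
      have c: "e \<in> carrier Q" "v \<in> carrier Q" "x [^] l \<in> carrier Q"
        using e sK(1) v in_carrier xc by auto
      have "e = ((d \<otimes> x [^] l) \<otimes> v) \<otimes> e" using v c by simp
      also have "\<dots> = d \<otimes> (v \<otimes> (e \<otimes> x [^] l))" using c dc by (simp add: m_ac)
      finally show "\<exists>b\<in>B. e = d \<otimes> b" using lB[OF e] v(1) sB(6) by blast
    qed
  qed
qed

section \<open>The trace ideal and the square of \<open>C\<close>\<close>

text \<open>The hypothesis \<open>D\<close> says that the square of \<open>C\<close> contains
  \<open>B\<close>; the other two characterize \<open>T\<close> as the ideal generated by the
  products of \<open>colon Q A C\<close> and \<open>C\<close>. For \<open>z\<close> in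
  \<open>colon Q A C\<close>, the elements that \<open>z\<close> multiplies into \<open>C\<close>
  form a module containing all products from \<open>C\<close>, hence all of \<open>B\<close>. So
  \<open>colon Q A C\<close> lies in the conductor, which absorbs \<open>C\<close>. Conversely,
  conductor elements reach \<open>T\<close> through the factor \<open>\<one>\<close> in
  \<open>C\<close>.\<close>

lemma square_imp_trace:
  assumes D: "\<And>V. scalar_closed Q A V \<Longrightarrow> (\<And>x y. x \<in> C \<Longrightarrow> y \<in> C \<Longrightarrow> x \<otimes> y \<in> V) \<Longrightarrow> B \<subseteq> V"
    and T: "\<And>x y. x \<in> colon Q A C \<Longrightarrow> y \<in> C \<Longrightarrow> x \<otimes> y \<in> T"
    and T_least: "\<And>V. scalar_closed Q A V \<Longrightarrow> V \<subseteq> A \<Longrightarrow>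
      (\<And>x y. x \<in> colon Q A C \<Longrightarrow> y \<in> C \<Longrightarrow> x \<otimes> y \<in> V) \<Longrightarrow> T \<subseteq> V"
  shows "T = conductor"
proof
  note sK = scalar_closedD[OF conductor_closed]
  have RC: "colon Q A C \<subseteq> conductor"
  proof
    fix z assume z: "z \<in> colon Q A C"
    then have zc: "z \<in> carrier Q" using colonD by blast
    define V where "V = {b \<in> carrier Q. z \<otimes> b \<in> C}"
    have "B \<subseteq> V"
    proof (rule D)
      show "scalar_closed Q A V"
        unfolding scalar_closed_def V_def
        using zc sC in_carrier by (auto simp: r_distr m_lcomm)
      fix x y assume xy: "x \<in> C" "y \<in> C"
      then have "(z \<otimes> x) \<otimes> y \<in> C" using z sC(4) colonD by blast
      then show "x \<otimes> y \<in> V" using zc xy in_carrier by (simp add: V_def m_assoc)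
    qed
    then show "z \<in> conductor"
      unfolding conductor_eq using zc by (auto intro!: colonI simp: V_def)
  qed
  show "T \<subseteq> conductor"
  proof (rule T_least)
    show "scalar_closed Q A conductor" "conductor \<subseteq> A"
      using scalar_closed_mono[OF conductor_closed A_sub_B] conductor_sub_A by auto
    fix x y assume xy: "x \<in> colon Q A C" "y \<in> C"
    then have "y \<otimes> x \<in> conductor" using RC C_B sK(4) by blast
    moreover have "x \<in> carrier Q" "y \<in> carrier Q" using xy colonD in_carrier by blast+
    ultimately show "x \<otimes> y \<in> conductor" by (simp add: m_comm)
  qed
  show "conductor \<subseteq> T"
  proof
    fix z assume z: "z \<in> conductor"
    then have "z \<in> colon Q A C" using C_B by (auto simp: colon_def)
    then have "z \<otimes> \<one> \<in> T" using T A_C sA(3) by blast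
    then show "z \<in> T" using z colonD(2) by fastforce
  qed
qed

text \<open>An element \<open>z\<close> of \<open>colon Q C D\<close> lies in
  \<open>colon Q A C\<close>, hence in \<open>T\<close> because \<open>\<one>\<close> is in
  \<open>C\<close>. Then \<open>B z\<close> stays in \<open>T\<close>, which is inside
  \<open>C\<close>. Thus \<open>B\<close> lies in the bidual of \<open>D\<close>, which reflexivity
  identifies with \<open>D\<close>.\<close>

lemma trace_imp_square:
  assumes T: "\<And>x y. x \<in> colon Q A C \<Longrightarrow> y \<in> C \<Longrightarrow> x \<otimes> y \<in> T"
    and T_A: "T \<subseteq> A"
    and T_B: "\<And>b x. b \<in> B \<Longrightarrow> x \<in> T \<Longrightarrow> b \<otimes> x \<in> T"
    and D: "scalar_closed Q A D" "\<And>x y. x \<in> C \<Longrightarrow> y \<in> C \<Longrightarrow> x \<otimes> y \<in> D" "D \<subseteq> B"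
  shows "D = B"
proof
  show "D \<subseteq> B" by fact
  have "\<one> \<otimes> \<one> \<in> D" using D(2) A_C sA(3) by blast
  then have "\<one> \<in> D" by simp
  then have dd: "bidual D \<subseteq> D" using reflexive[OF D(1,3)] by auto
  show "B \<subseteq> D"
  proof
    fix r assume r: "r \<in> B"
    have rc: "r \<in> carrier Q" using r in_carrier by blast
    have "r \<in> bidual D"
    proof (rule colonI[OF rc])
      fix z assume z: "z \<in> colon Q C D"
      then have zc: "z \<in> carrier Q" using colonD by blast
      have "z \<in> colon Q A C"
      proof (rule colonI[OF zc])
        fix c assume c: "c \<in> C"
        have "z \<otimes> c \<in> colon Q C C"
        proof (rule colonI)
          show "z \<otimes> c \<in> carrier Q" using zc c in_carrier by simp
          fix c' assume c': "c' \<in> C"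
          then have "z \<otimes> (c \<otimes> c') \<in> C" using z D(2) c colonD by blast
          then show "z \<otimes> c \<otimes> c' \<in> C" using zc c c' in_carrier by (simp add: m_assoc)
        qed
        then show "z \<otimes> c \<in> A" using colon_C_C by simp
      qed
      then have "z \<otimes> \<one> \<in> T" using T A_C sA(3) by blast
      then have "r \<otimes> z \<in> T" using T_B[OF r] zc by simp
      then show "r \<otimes> z \<in> C" using T_A A_C by blast
    qed
    then show "r \<in> D" using dd by blast
  qed
qed

end

section \<open>The total ring of fractions\<close>

locale fraction_ring = cring Q for Q :: "('a, 'n) ring_scheme" (structure) +
  fixes R :: "('a, 'm) ring_scheme"
  assumes total: "total_ring_of_fractions R Q"
begin

lemma cring_R: "cring R"
  using total by (simp add: total_ring_of_fractions_def)

sublocale R: cring R by (rule cring_R)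

lemma id_hom: "(\<lambda>x. x) \<in> ring_hom R Q"
  using total by (simp add: total_ring_of_fractions_def)

lemma R_ops:
  "a \<in> carrier R \<Longrightarrow> a \<in> carrier Q"
  "a \<in> carrier R \<Longrightarrow> b \<in> carrier R \<Longrightarrow> a \<otimes>\<^bsub>R\<^esub> b = a \<otimes> b"
  "a \<in> carrier R \<Longrightarrow> b \<in> carrier R \<Longrightarrow> a \<oplus>\<^bsub>R\<^esub> b = a \<oplus> b"
  "\<one>\<^bsub>R\<^esub> = \<one>" "\<zero>\<^bsub>R\<^esub> = \<zero>"
  using ring_hom_memE[OF id_hom] ring_hom_zero[OF id_hom R.ring_axioms ring_axioms] by auto

lemma subring_R: "subring (carrier R) Q"
proof (rule subringI)
  show "\<ominus> a \<in> carrier R" if a: "a \<in> carrier R" for a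
  proof -
    have "a \<oplus> (\<ominus>\<^bsub>R\<^esub> a) = \<zero>" using R_ops(3,5) R.r_neg a by (metis R.a_inv_closed)
    then have "\<ominus> a = \<ominus>\<^bsub>R\<^esub> a" using a R_ops(1) R.a_inv_closed by (metis minus_equality a_comm)
    then show ?thesis using a by simp
  qed
qed (use R_ops in \<open>auto simp flip: R_ops(2-4)\<close>)

lemma nonzerodivisor_unit: "u \<in> non_zerodivisors R \<Longrightarrow> u \<in> Units Q"
  using total by (auto simp: total_ring_of_fractions_def)

lemma unit_nonzerodivisor: "u \<in> carrier R \<Longrightarrow> u \<in> Units Q \<Longrightarrow> u \<in> non_zerodivisors R"
  unfolding non_zerodivisors_def
  using R_ops by (auto simp: Units_l_cancel) (metis Units_l_cancel r_null zero_closed)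

lemma denominator:
  assumes "x \<in> carrier Q"
  shows "\<exists>s\<in>carrier R. s \<in> Units Q \<and> s \<otimes> x \<in> carrier R"
proof -
  obtain a s where h: "x = a \<otimes> inv s" "a \<in> carrier R" "s \<in> non_zerodivisors R"
    using assms total by (auto simp: total_ring_of_fractions_def)
  then have s: "s \<in> carrier R" "s \<in> Units Q"
    using nonzerodivisor_unit by (auto simp: non_zerodivisors_def)
  then have "s \<otimes> x = a" using h R_ops(1) by (simp add: m_lcomm[of s a])
  then show ?thesis using s h by blast
qed

lemma ideal_of_scalar_closed:
  assumes "scalar_closed Q (carrier R) I" "I \<subseteq> carrier R"
  shows "ideal I R"
proof (rule idealI)
  note sI = scalar_closedD[OF assms(1)]
  have I: "x \<in> carrier R" if "x \<in> I" for x using assms(2) that by blast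
  show "subgroup I (add_monoid R)"
  proof (rule R.add.subgroupI)
    show "I \<subseteq> carrier R" by fact
    show "I \<noteq> {}" using sI(2) by blast
    show "\<ominus>\<^bsub>R\<^esub> x \<in> I" if "x \<in> I" for x
    proof -
      have "\<ominus>\<^bsub>R\<^esub> x = (\<ominus>\<^bsub>R\<^esub> \<one>\<^bsub>R\<^esub>) \<otimes>\<^bsub>R\<^esub> x" using I[OF that] by (simp add: R.l_minus)
      also have "\<dots> = (\<ominus>\<^bsub>R\<^esub> \<one>\<^bsub>R\<^esub>) \<otimes> x" using I[OF that] by (simp add: R_ops(2))
      finally show ?thesis using sI(4) that by simp
    qed
    show "x \<oplus>\<^bsub>R\<^esub> y \<in> I" if "x \<in> I" "y \<in> I" for x y
      using sI(3) that I by (simp add: R_ops(3))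
  qed
  show "x \<otimes>\<^bsub>R\<^esub> a \<in> I" if "a \<in> I" "x \<in> carrier R" for a x
    using sI(4) that I by (simp add: R_ops(2))
  then show "a \<otimes>\<^bsub>R\<^esub> x \<in> I" if "a \<in> I" "x \<in> carrier R" for a x
    using that I by (simp add: R.m_comm)
qed (rule R.ring_axioms)

lemma scalar_closed_of_ideal:
  assumes "ideal I R"
  shows "scalar_closed Q (carrier R) I"
proof -
  interpret I: ideal I R by fact
  show ?thesis
    unfolding scalar_closed_def
  proof (intro conjI ballI)
    show "I \<subseteq> carrier Q" using R_ops(1) I.Icarr by blast
    show "\<zero> \<in> I"
      using additive_subgroup.zero_closed[OF I.additive_subgroup_axioms] by (simp add: R_ops(5))
    show "x \<oplus> y \<in> I" if "x \<in> I" "y \<in> I" for x y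
      using additive_subgroup.a_closed[OF I.additive_subgroup_axioms that] that I.Icarr
      by (simp add: R_ops(3))
    show "a \<otimes> x \<in> I" if "a \<in> carrier R" "x \<in> I" for a x
      using I.I_l_closed[OF that(2,1)] that I.Icarr by (simp add: R_ops(2))
  qed
qed

lemma sub_module_module:
  assumes "scalar_closed Q (carrier R) V"
  shows "module R (sub_module_of_ring Q V)"
proof -
  note sV = scalar_closedD[OF assms]
  have V: "x \<in> carrier Q" if "x \<in> V" for x using sV(1) that by blast
  have "abelian_group (sub_module_of_ring Q V)"
  proof (rule abelian_groupI, unfold sub_module_simps)
    show "\<exists>y\<in>V. y \<oplus> x = \<zero>" if "x \<in> V" for x
      using scalar_closed_uminus[OF subring_R assms that] V[OF that] l_neg by blast
  qed (use sV V in \<open>auto simp: a_ac\<close>)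
  then show ?thesis
    by (intro moduleI, unfold sub_module_simps)
      (use sV V R_ops in \<open>auto simp: l_distr r_distr m_assoc R.cring_axioms\<close>)
qed

lemma submodule_iff_scalar_closed:
  "submodule V R (sub_module_of_ring Q (carrier Q)) \<longleftrightarrow> scalar_closed Q (carrier R) V"
proof
  have "scalar_closed Q (carrier R) (carrier Q)"
    using R_ops(1) by (simp add: scalar_closed_def)
  note Qm = sub_module_module[OF this]
  show "scalar_closed Q (carrier R) V" if "submodule V R (sub_module_of_ring Q (carrier Q))"
    using module.submoduleE[OF Qm that] submodule.axioms(1)[OF that] subgroup.one_closed
    by (force simp: scalar_closed_def sub_module_simps)
  show "submodule V R (sub_module_of_ring Q (carrier Q))" if "scalar_closed Q (carrier R) V"
    using scalar_closedD[OF that] by (intro submodule_scalarI[OF Qm]) (auto simp: sub_module_simps)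
qed

text \<open>Clear the denominator of \<open>x\<close>: with \<open>s\<close> and
  \<open>s \<otimes> x\<close> in \<open>R\<close>, linearity gives
  \<open>s f(x) = f(s x) = s x f(1)\<close>, and the unit \<open>s\<close> cancels. This replaces
  abstract homomorphisms by elements of a colon.\<close>

lemma linear_is_multiplication:
  assumes f: "f \<in> module_hom R (sub_module_of_ring Q V) (sub_module_of_ring Q U)"
    and V: "scalar_closed Q (carrier R) V" "\<one> \<in> V" and U: "U \<subseteq> carrier Q" and x: "x \<in> V"
  shows "f x = x \<otimes> f \<one>"
proof -
  note fD = module_homD[OF f, unfolded sub_module_simps]
  have xc: "x \<in> carrier Q" using scalar_closedD(1)[OF V(1)] x by blast
  have c: "f x \<in> carrier Q" "f \<one> \<in> carrier Q" using fD(1) x V(2) U by blast+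
  obtain s where s: "s \<in> carrier R" "s \<in> Units Q" "s \<otimes> x \<in> carrier R"
    using denominator[OF xc] by blast
  have sc: "s \<in> carrier Q" using s by blast
  have "s \<otimes> f x = f ((s \<otimes> x) \<otimes> \<one>)" using fD(3)[OF s(1) x] xc sc by simp
  also have "\<dots> = (s \<otimes> x) \<otimes> f \<one>" using fD(3)[OF s(3) V(2)] .
  also have "\<dots> = s \<otimes> (x \<otimes> f \<one>)" using sc xc c by (simp add: m_assoc)
  finally show ?thesis using s(2) c xc by (simp add: Units_l_cancel)
qed

lemma common_denominator:
  assumes "finite S" "S \<subseteq> carrier Q"
  shows "\<exists>s\<in>carrier R. s \<in> Units Q \<and> (\<forall>x\<in>S. s \<otimes> x \<in> carrier R)"
  using assms
proof (induction S)
  case empty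
  then show ?case using subringE(3)[OF subring_R] by (intro bexI[of _ \<one>]) auto
next
  case (insert x S)
  obtain s where s: "s \<in> carrier R" "s \<in> Units Q" "\<forall>x\<in>S. s \<otimes> x \<in> carrier R"
    using insert by auto
  obtain t where t: "t \<in> carrier R" "t \<in> Units Q" "t \<otimes> x \<in> carrier R"
    using denominator insert by blast
  have c: "s \<in> carrier Q" "t \<in> carrier Q" "x \<in> carrier Q" using s t insert by auto
  note mult = subringE(6)[OF subring_R]
  show ?case
  proof (intro bexI[of _ "s \<otimes> t"] conjI ballI)
    show "s \<otimes> t \<in> carrier R" "s \<otimes> t \<in> Units Q" using s t mult by auto
    fix y assume "y \<in> insert x S"
    then consider "y = x" | "y \<in> S" by blast
    then show "s \<otimes> t \<otimes> y \<in> carrier R"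
    proof cases
      case 1
      then show ?thesis using mult[OF s(1) t(3)] c by (simp add: m_assoc)
    next
      case 2
      then have "t \<otimes> (s \<otimes> y) \<in> carrier R" "y \<in> carrier Q" using mult t(1) s(3) insert by auto
      then show ?thesis using c by (simp add: m_ac)
    qed
  qed
qed

text \<open>A common denominator of the generators works for all of \<open>V\<close>, because the
  elements that it clears form a submodule.\<close>

lemma finitely_generated_denominator:
  assumes V: "scalar_closed Q (carrier R) V"
    and fin: "finitely_generated_module R (sub_module_of_ring Q V)"
  shows "\<exists>s\<in>carrier R. s \<in> Units Q \<and> (\<forall>x\<in>V. s \<otimes> x \<in> carrier R)"
proof -
  note sV = scalar_closedD[OF V]
  obtain S where S: "finite S" "S \<subseteq> V" "module_span R (sub_module_of_ring Q V) S = V"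
    using fin by (auto simp: finitely_generated_module_def sub_module_simps)
  then obtain s where s: "s \<in> carrier R" "s \<in> Units Q" "\<forall>x\<in>S. s \<otimes> x \<in> carrier R"
    using common_denominator[of S] sV(1) by blast
  have sc: "s \<in> carrier Q" using s by blast
  define N where "N = {x \<in> V. s \<otimes> x \<in> carrier R}"
  note sR = subringE[OF subring_R]
  have "submodule N R (sub_module_of_ring Q V)"
  proof (rule submodule_scalarI[OF sub_module_module[OF V]], unfold sub_module_simps)
    show "N \<subseteq> V" by (auto simp: N_def)
    show "\<zero> \<in> N" using sV(2) sc sR(2) by (simp add: N_def)
    show "x \<oplus> y \<in> N" if "x \<in> N" "y \<in> N" for x y
      using that sV(1,3) sc sR(7) by (auto simp: N_def r_distr subset_iff)
    show "a \<otimes> x \<in> N" if "a \<in> carrier R" "x \<in> N" for a x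
    proof -
      have "x \<in> carrier Q" "a \<otimes> (s \<otimes> x) \<in> carrier R"
        using that sV(1) sR(6) by (auto simp: N_def)
      then show ?thesis using that sV(4) sc R_ops(1) by (simp add: N_def m_lcomm)
    qed
  qed
  moreover have "S \<subseteq> N" using S(2) s(3) by (auto simp: N_def)
  ultimately have "module_span R (sub_module_of_ring Q V) S \<subseteq> N"
    unfolding module_span_def by blast
  then have "V \<subseteq> N" using S(3) by simp
  then show ?thesis using s by (auto simp: N_def)
qed

lemma colon_hom:
  assumes "V \<subseteq> carrier Q" "x \<in> colon Q U V"
  shows "(\<lambda>v. x \<otimes> v) \<in> module_hom R (sub_module_of_ring Q V) (sub_module_of_ring Q U)"
  using assms R_ops(1)
  by (intro module_homI) (auto simp: sub_module_simps colon_def r_distr m_lcomm subset_iff)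

text \<open>A subset of \<open>R\<close> becomes a module either through the operations of
  \<open>R\<close> or through those of \<open>Q\<close>. These are different records whose
  operations agree there, so one form can be traded for the other.\<close>

lemma module_hom_restrict_scalars:
  assumes "T \<subseteq> carrier R"
  shows "module_hom R (sub_module_of_ring R T) N = module_hom R (sub_module_of_ring Q T) N"
    and "module_hom R N (sub_module_of_ring R T) = module_hom R N (sub_module_of_ring Q T)"
proof -
  have T: "x \<in> carrier R" if "x \<in> T" for x using assms that by blast
  show "module_hom R (sub_module_of_ring R T) N = module_hom R (sub_module_of_ring Q T) N"
    unfolding module_hom_def sub_module_simps using R_ops(2,3) T by auto
  show "module_hom R N (sub_module_of_ring R T) = module_hom R N (sub_module_of_ring Q T)"
    unfolding module_hom_def sub_module_simps using R_ops(2,3) T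
    by (auto simp: Pi_iff)
qed

end

section \<open>The equivalence of the three conditions\<close>

theorem theorem2p5:
  fixes R :: "('a, 'm) ring_scheme"
    and Q :: "('a, 'n) ring_scheme"
    and \<omega> :: "('a, 'w, 'p) module_scheme"
    and C :: "'a set"
  assumes "cohen_macaulay_local_ring R"
    and "krull_dim R = 1"
    and "canonical_module R \<omega>"
    and "total_ring_of_fractions R Q"
    and "canonical_submodule R Q \<omega> C"
    and "finitely_generated_module R (sub_module_of_ring Q (integral_closure R Q))"
    and "local_ring (Q\<lparr>carrier := integral_closure R Q\<rparr>)"
  shows "(far_flung_gorenstein R Q \<omega> \<longleftrightarrow>
            module_isomorphic R (sub_module_of_ring R (trace_ideal R \<omega>))
                                (sub_module_of_ring Q (integral_closure R Q))) \<and>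
         (module_isomorphic R (sub_module_of_ring R (trace_ideal R \<omega>))
                              (sub_module_of_ring Q (integral_closure R Q)) \<longleftrightarrow>
            module_product R Q C C = integral_closure R Q)"
proof -
  define A where "A = carrier R"
  define B where "B = integral_closure R Q"
  define M where "M = max_ideal R"
  define T where "T = trace_ideal R \<omega>"
  define D where "D = module_product R Q C C"
  interpret Q: cring Q using assms(4) by (simp add: total_ring_of_fractions_def)
  have frac: "fraction_ring Q R"
    by (intro fraction_ring.intro fraction_ring_axioms.intro Q.cring_axioms assms(4))
  interpret F: fraction_ring Q R by (rule frac)
  have local: "local_ring R" and noeth: "noetherian_ring R" and depth: "depth R = 1"
    using assms(1,2) by (simp_all add: cohen_macaulay_local_ring_def)
  interpret N: noetherian_ring R by (rule noeth)
  have max: "maximalideal M R" unfolding M_def by (rule local_ring_maximalideal[OF local])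
  interpret M: maximalideal M R by (rule max)
  have \<omega>: "module R \<omega>" using assms(3) by (simp add: canonical_module_def)
  have ext1: "ext_isomorphic R 1 (residue_field_module R) \<omega> (residue_field_module R)"
    using assms(2,3) by (auto simp: canonical_module_def one_enat_def dest: spec[of _ 1])
  have subA: "subring A Q" unfolding A_def by (rule F.subring_R)
  have C: "scalar_closed Q A C" "A \<subseteq> C" "C \<subseteq> B"
    using assms(5) F.submodule_iff_scalar_closed
    by (auto simp: canonical_submodule_def A_def B_def)
  have BQ: "B \<subseteq> carrier Q" by (auto simp: B_def integral_closure_def)
  have cringB: "cring (Q\<lparr>carrier := B\<rparr>)" using assms(7) by (simp add: local_ring_def B_def)
  have subB: "subring B Q"
    by (rule Q.ring_incl_imp_subring[OF BQ cring.axioms(1)[OF cringB]])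
  note sA = subringE[OF subA] and sB = subringE[OF subB] and sC = scalar_closedD[OF C(1)]
  have AB: "A \<subseteq> B" using C by blast
  have B_closed: "scalar_closed Q A B"
    using sB(1,2,6,7) AB by (auto simp: scalar_closed_def)
  obtain s where s: "s \<in> A" "s \<in> Units Q" "\<And>x. x \<in> B \<Longrightarrow> s \<otimes>\<^bsub>Q\<^esub> x \<in> A"
    using F.finitely_generated_denominator[of B] B_closed assms(6) unfolding A_def B_def by blast
  have CQ: "C \<subseteq> carrier Q" using sC(1) .
  have one_C: "\<one>\<^bsub>Q\<^esub> \<in> C" using C(2) sA(3) by blast
  let ?C = "sub_module_of_ring Q C"
  have Cmod: "module R ?C" using F.sub_module_module C(1) by (simp add: A_def)
  obtain \<phi> where \<phi>: "\<phi> \<in> module_hom R ?C \<omega>" "bij_betw \<phi> C (carrier \<omega>)"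
    using assms(5) by (auto simp: canonical_submodule_def module_isomorphic_def sub_module_simps)
  note \<phi>D = module_homD[OF \<phi>(1), unfolded sub_module_simps]
  define \<chi> where "\<chi> = inv_into C \<phi>"
  have \<chi>: "\<chi> \<in> module_hom R \<omega> ?C"
    unfolding \<chi>_def using module_iso_sym[OF Cmod \<phi>(1)] \<phi>(2) by (simp add: sub_module_simps)
  have \<phi>\<chi>: "\<phi> (\<chi> w) = w" "\<chi> w \<in> C" if "w \<in> carrier \<omega>" for w
    using \<phi>(2) that by (auto simp: \<chi>_def bij_betw_def f_inv_into_f inv_into_into)
  have \<chi>\<phi>: "\<chi> (\<phi> c) = c" if "c \<in> C" for c
    using \<phi>(2) that by (simp add: \<chi>_def bij_betw_def)
  have \<phi>_inj: "c = c'" if "\<phi> c = \<phi> c'" "c \<in> C" "c' \<in> C" for c c'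
    using \<chi>\<phi> that by metis
  have MA: "M \<subseteq> A" using M.Icarr by (auto simp: A_def)
  obtain t where t: "t \<in> M" "t \<in> Units Q"
    using depth_one_nonzerodivisor[OF F.cring_R depth] F.nonzerodivisor_unit by (auto simp: M_def)
  have tc: "t \<in> carrier Q" using t by blast
  have MQ: "M \<subseteq> carrier Q" using MA sA(1) by blast
  have type1: "\<exists>r\<in>A. z \<ominus>\<^bsub>Q\<^esub> r \<otimes>\<^bsub>Q\<^esub> z' \<in> C"
    if z: "z \<in> colon Q C M" and z': "z' \<in> colon Q C M" "z' \<notin> C" for z z'
  proof -
    \<comment> \<open>An element \<open>y\<close> of \<open>colon Q C M\<close> acts as a
      homomorphism from the maximal ideal to \<open>C\<close>, carried over to \<omega> by \<phi>.
      In this way \<open>ext1_dimension_one\<close> turns into \<open>type1\<close>.\<close>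
    have hom: "(\<lambda>p. \<phi> (y \<otimes>\<^bsub>Q\<^esub> p)) \<in> module_hom R (sub_module_of_ring R M) \<omega>" if "y \<in> colon Q C M" for y
      using module_hom_comp[OF F.colon_hom[OF MQ that] \<phi>(1)]
      by (simp add: A_def F.module_hom_restrict_scalars(1)[OF MA[unfolded A_def]])
    have zc: "z \<in> carrier Q" "z' \<in> carrier Q" using z z' by (auto simp: colon_def)
    have zp: "y \<otimes>\<^bsub>Q\<^esub> p \<in> C" if "y \<in> colon Q C M" "p \<in> M" for y p using that by (simp add: colon_def)
    have smult: "p \<odot>\<^bsub>\<omega>\<^esub> w = \<phi> (p \<otimes>\<^bsub>Q\<^esub> \<chi> w)" if "p \<in> A" "w \<in> carrier \<omega>" for p w
      using \<phi>D(3)[of p "\<chi> w"] \<phi>\<chi>[OF that(2)] that(1) by (simp add: A_def)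
    \<comment> \<open>If the homomorphism of \<open>z'\<close> were given by some \<open>w\<close>,
      its value at \<open>t\<close> would already force \<open>z' = \<chi> w\<close>, since
      \<open>t\<close> cancels in \<open>Q\<close>; but \<chi> w lies in \<open>C\<close>.\<close>
    have "\<not> (\<exists>w\<in>carrier \<omega>. \<forall>p\<in>max_ideal R. \<phi> (z' \<otimes>\<^bsub>Q\<^esub> p) = p \<odot>\<^bsub>\<omega>\<^esub> w)"
    proof
      assume "\<exists>w\<in>carrier \<omega>. \<forall>p\<in>max_ideal R. \<phi> (z' \<otimes>\<^bsub>Q\<^esub> p) = p \<odot>\<^bsub>\<omega>\<^esub> w"
      then obtain w where w: "w \<in> carrier \<omega>" "\<phi> (z' \<otimes>\<^bsub>Q\<^esub> t) = t \<odot>\<^bsub>\<omega>\<^esub> w"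
        using t(1) by (auto simp: M_def)
      have tw: "t \<otimes>\<^bsub>Q\<^esub> \<chi> w \<in> C" using sC(4) t(1) MA \<phi>\<chi>(2)[OF w(1)] by blast
      have "z' \<otimes>\<^bsub>Q\<^esub> t = t \<otimes>\<^bsub>Q\<^esub> \<chi> w"
        using \<phi>_inj[OF _ zp[OF z'(1) t(1)] tw] w smult[of t w] t(1) MA by auto
      then have "t \<otimes>\<^bsub>Q\<^esub> z' = t \<otimes>\<^bsub>Q\<^esub> \<chi> w" using zc tc by (simp add: Q.m_comm)
      then have "z' = \<chi> w"
        using zc \<phi>\<chi>(2)[OF w(1)] CQ t(2) Q.Units_l_cancel by blast
      then show False using \<phi>\<chi>(2)[OF w(1)] z' by simp
    qed
    \<comment> \<open>Evaluation at the single element \<open>t\<close> is enough here too: the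
      relation can be pulled back to \<open>Q\<close> and divided by the unit
      \<open>t\<close>.\<close>
    from ext1_dimension_one[OF F.cring_R max[unfolded M_def] \<omega> ext1
        hom[OF z, unfolded M_def] hom[OF z'(1), unfolded M_def] this]
    obtain r w where r: "r \<in> A" "w \<in> carrier \<omega>"
      "\<phi> (z \<otimes>\<^bsub>Q\<^esub> t) = r \<odot>\<^bsub>\<omega>\<^esub> \<phi> (z' \<otimes>\<^bsub>Q\<^esub> t) \<oplus>\<^bsub>\<omega>\<^esub> t \<odot>\<^bsub>\<omega>\<^esub> w"
      using t(1) by (auto simp: M_def A_def)
    define c where "c = \<chi> w"
    have c: "c \<in> C" "c \<in> carrier Q" using \<phi>\<chi>(2)[OF r(2)] CQ by (auto simp: c_def)
    have rc: "r \<in> carrier Q" using r sA(1) by blast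
    have in_C: "r \<otimes>\<^bsub>Q\<^esub> (z' \<otimes>\<^bsub>Q\<^esub> t) \<in> C" "t \<otimes>\<^bsub>Q\<^esub> c \<in> C"
      using sC(4) r(1) zp[OF z'(1) t(1)] c t(1) MA by blast+
    have "\<phi> (z \<otimes>\<^bsub>Q\<^esub> t) = \<phi> (r \<otimes>\<^bsub>Q\<^esub> (z' \<otimes>\<^bsub>Q\<^esub> t) \<oplus>\<^bsub>Q\<^esub> t \<otimes>\<^bsub>Q\<^esub> c)"
    proof -
      have "t \<in> A" using t MA by blast
      then show ?thesis
        using r(3) smult[OF _ r(2)] \<phi>D(2)[OF in_C] \<phi>D(3)[of r] r(1) zp[OF z'(1) t(1)]
        by (simp add: A_def c_def)
    qed
    then have "z \<otimes>\<^bsub>Q\<^esub> t = r \<otimes>\<^bsub>Q\<^esub> (z' \<otimes>\<^bsub>Q\<^esub> t) \<oplus>\<^bsub>Q\<^esub> t \<otimes>\<^bsub>Q\<^esub> c"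
      using \<phi>_inj zp[OF z t(1)] sC(3)[OF in_C] by blast
    also have "\<dots> = t \<otimes>\<^bsub>Q\<^esub> (r \<otimes>\<^bsub>Q\<^esub> z' \<oplus>\<^bsub>Q\<^esub> c)"
      using rc zc tc c by (simp add: Q.r_distr Q.m_ac)
    finally have "t \<otimes>\<^bsub>Q\<^esub> z = t \<otimes>\<^bsub>Q\<^esub> (r \<otimes>\<^bsub>Q\<^esub> z' \<oplus>\<^bsub>Q\<^esub> c)"
      using zc tc by (simp add: Q.m_comm)
    then have "z = r \<otimes>\<^bsub>Q\<^esub> z' \<oplus>\<^bsub>Q\<^esub> c"
      using Q.Units_l_cancel[OF t(2)] zc rc c by simp
    then have "z \<ominus>\<^bsub>Q\<^esub> r \<otimes>\<^bsub>Q\<^esub> z' = c"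
      using zc rc c by (simp add: Q.minus_eq Q.a_comm[of _ c] Q.a_assoc Q.r_neg)
    then show ?thesis using r c by auto
  qed
  interpret S: fractional_setting Q A M B C s
  proof (rule fractional_setting.intro[OF Q.cring_axioms], rule fractional_setting_axioms.intro, goal_cases)
    case 1 show ?case by (rule subA)
  next
    case 2 show ?case by (rule subB)
  next
    case 3 show ?case by (rule MA)
  next
    case 4 show ?case
      using additive_subgroup.zero_closed[OF M.additive_subgroup_axioms] by (simp add: F.R_ops(5))
  next
    case 5 show ?case
      using M.one_imp_carrier M.I_notcarr by (auto simp: F.R_ops(4))
  next
    case (6 Fam)
    show ?case
      by (rule N.maximal_ideal_of_family[OF 6(1)])
        (use 6(2) F.ideal_of_scalar_closed in \<open>auto simp: A_def\<close>)
  next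
    case (7 I u)
    have I: "ideal I R" using 7(1,2) F.ideal_of_scalar_closed by (simp add: A_def)
    have "primeideal I R"
    proof (rule primeidealI[OF I F.cring_R])
      show "carrier R \<noteq> I" using 7(3) sA(3) by (auto simp: A_def)
      show "a \<in> I \<or> b \<in> I" if "a \<in> carrier R" "b \<in> carrier R" "a \<otimes>\<^bsub>R\<^esub> b \<in> I" for a b
        using 7(4)[of a b] that by (simp add: A_def F.R_ops(2))
    qed
    moreover have "u \<in> non_zerodivisors R"
      using F.unit_nonzerodivisor 7(2,5,6) by (auto simp: A_def)
    ultimately show ?case
      using N.prime_with_nonzerodivisor_maximal[OF local assms(2) _ 7(5)] by (simp add: M_def)
  next
    case 8 show ?case by (rule s)
  next
    case 9 show ?case by (rule s)
  next
    case (10 b) then show ?case by (rule s)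
  next
    case (11 x p)
    then have "set (\<one>\<^bsub>Q\<^esub> # p) \<subseteq> carrier R" "hd (\<one>\<^bsub>Q\<^esub> # p) = \<one>\<^bsub>R\<^esub>"
      using sA(3) by (simp_all add: A_def F.R_ops(4))
    then show ?case unfolding B_def integral_closure_def using 11 by blast
  next
    case (12 x y)
    have U: "v \<in> Units (Q\<lparr>carrier := B\<rparr>) \<longleftrightarrow> v \<in> B \<and> (\<exists>z\<in>B. v \<otimes>\<^bsub>Q\<^esub> z = \<one>\<^bsub>Q\<^esub>)" for v
    proof -
      have "z \<otimes>\<^bsub>Q\<^esub> v = v \<otimes>\<^bsub>Q\<^esub> z" if "z \<in> B" "v \<in> B" for z
        using that BQ Q.m_comm by blast
      then show ?thesis by (auto simp: Units_def)
    qed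
    have "x \<oplus>\<^bsub>Q\<^esub> y \<in> B" using sB(7) 12 by blast
    then show ?case
      using local_ring_unit_of_add[of "Q\<lparr>carrier := B\<rparr>" x y] 12 assms(7)
      unfolding U by (simp add: B_def)
  next
    case 13 show ?case by (rule C)
  next
    case 14 show ?case by (rule C)
  next
    case 15 show ?case by (rule C)
  next
    case (16 z z') then show ?case by (rule type1)
  qed
  \<comment> \<open>Through \<phi>, homomorphisms from \<omega> to \<open>R\<close> become
    homomorphisms from \<open>C\<close> to \<open>A\<close>. Each is multiplication by its value at
    one, an element of \<open>colon Q A C\<close>, so the images consist exactly of these
    products.\<close>
  have Tgen: "T = Idl\<^bsub>R\<^esub> {x \<otimes>\<^bsub>Q\<^esub> y |x y. x \<in> colon Q A C \<and> y \<in> C}"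
  proof -
    have "(\<Union>f \<in> module_hom R \<omega> (sub_module_of_ring R (carrier R)). f ` carrier \<omega>)
        = {x \<otimes>\<^bsub>Q\<^esub> y |x y. x \<in> colon Q A C \<and> y \<in> C}" (is "?L = ?R")
    proof (intro equalityI subsetI)
      fix v assume "v \<in> ?L"
      then obtain f w where f: "f \<in> module_hom R \<omega> (sub_module_of_ring Q A)"
        and w: "w \<in> carrier \<omega>" "v = f w"
        by (auto simp: A_def F.module_hom_restrict_scalars(2)[OF subset_refl])
      define g where "g c = f (\<phi> c)" for c
      have g: "g \<in> module_hom R ?C (sub_module_of_ring Q A)"
        unfolding g_def by (rule module_hom_comp[OF \<phi>(1) f])
      note gD = module_homD[OF g, unfolded sub_module_simps]
      have lin: "g c = g \<one>\<^bsub>Q\<^esub> \<otimes>\<^bsub>Q\<^esub> c" if c: "c \<in> C" for c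
      proof -
        have "g c = c \<otimes>\<^bsub>Q\<^esub> g \<one>\<^bsub>Q\<^esub>"
          using F.linear_is_multiplication[OF g _ one_C sA(1) c] C(1) by (simp add: A_def)
        then show ?thesis using c CQ gD(1)[OF one_C] sA(1) by (metis Q.m_comm subsetD)
      qed
      have "g \<one>\<^bsub>Q\<^esub> \<in> colon Q A C"
        using gD(1)[OF one_C] gD(1) lin[symmetric] sA(1) by (auto simp: colon_def)
      moreover have "v = g \<one>\<^bsub>Q\<^esub> \<otimes>\<^bsub>Q\<^esub> \<chi> w"
        using lin[OF \<phi>\<chi>(2)[OF w(1)]] \<phi>\<chi>(1)[OF w(1)] w(2) by (simp add: g_def)
      ultimately show "v \<in> ?R" using \<phi>\<chi>(2)[OF w(1)] by blast
    next
      fix v assume "v \<in> ?R"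
      then obtain x y where xy: "x \<in> colon Q A C" "y \<in> C" "v = x \<otimes>\<^bsub>Q\<^esub> y" by blast
      have "(\<lambda>w. x \<otimes>\<^bsub>Q\<^esub> \<chi> w) \<in> module_hom R \<omega> (sub_module_of_ring R A)"
        using module_hom_comp[OF \<chi> F.colon_hom[OF CQ xy(1)]]
        by (simp add: A_def F.module_hom_restrict_scalars(2)[OF subset_refl])
      moreover have "v = x \<otimes>\<^bsub>Q\<^esub> \<chi> (\<phi> y)" "\<phi> y \<in> carrier \<omega>" using xy \<chi>\<phi> \<phi>D(1) by auto
      ultimately show "v \<in> ?L" unfolding A_def by blast
    qed
    then show ?thesis by (simp add: T_def trace_ideal_def)
  qed
  have gen_sub: "{x \<otimes>\<^bsub>Q\<^esub> y |x y. x \<in> colon Q A C \<and> y \<in> C} \<subseteq> carrier R"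
    by (auto simp: colon_def A_def)
  have T_ideal: "ideal T R" unfolding Tgen by (rule F.R.genideal_ideal[OF gen_sub])
  have T_A: "T \<subseteq> A" using ideal.Icarr[OF T_ideal] by (auto simp: A_def)
  have T_closed: "scalar_closed Q A T"
    using F.scalar_closed_of_ideal[OF T_ideal] by (simp add: A_def)
  have T_prod: "x \<otimes>\<^bsub>Q\<^esub> y \<in> T" if "x \<in> colon Q A C" "y \<in> C" for x y
    using F.R.genideal_self[OF gen_sub] that unfolding Tgen by blast
  have T_least: "T \<subseteq> V"
    if "scalar_closed Q A V" "V \<subseteq> A" "\<And>x y. x \<in> colon Q A C \<Longrightarrow> y \<in> C \<Longrightarrow> x \<otimes>\<^bsub>Q\<^esub> y \<in> V" for V
    unfolding Tgen
    by (rule F.R.genideal_minimal) (use that F.ideal_of_scalar_closed in \<open>auto simp: A_def\<close>)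
  have D_eq: "D = \<Inter>{V. scalar_closed Q A V \<and> {x \<otimes>\<^bsub>Q\<^esub> y |x y. x \<in> C \<and> y \<in> C} \<subseteq> V}"
    unfolding D_def module_product_def module_span_def F.submodule_iff_scalar_closed A_def ..
  have D_B: "D \<subseteq> B"
  proof -
    have "{x \<otimes>\<^bsub>Q\<^esub> y |x y. x \<in> C \<and> y \<in> C} \<subseteq> B" using C(3) sB(6) by blast
    then show ?thesis unfolding D_eq using B_closed by blast
  qed
  have D_prod: "x \<otimes>\<^bsub>Q\<^esub> y \<in> D" if "x \<in> C" "y \<in> C" for x y
    unfolding D_eq using that by blast
  have D_closed: "scalar_closed Q A D"
    unfolding scalar_closed_def
  proof (intro conjI ballI)
    show "D \<subseteq> carrier Q" using D_B BQ by blast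
  qed (auto simp: D_eq dest: scalar_closedD)
  have trace_square: "D = B" if "\<And>b x. b \<in> B \<Longrightarrow> x \<in> T \<Longrightarrow> b \<otimes>\<^bsub>Q\<^esub> x \<in> T"
    using S.trace_imp_square[OF T_prod T_A that D_closed D_prod D_B] .
  have square_trace: "T = colon Q A B" if "D = B"
  proof (rule S.square_imp_trace[OF _ T_prod T_least])
    show "B \<subseteq> V" if "scalar_closed Q A V" "\<And>x y. x \<in> C \<Longrightarrow> y \<in> C \<Longrightarrow> x \<otimes>\<^bsub>Q\<^esub> y \<in> V" for V
      using that \<open>D = B\<close> unfolding D_eq by blast
  qed
  have i: "far_flung_gorenstein R Q \<omega> \<longleftrightarrow> T = colon Q A B"
    using assms by (auto simp: far_flung_gorenstein_def T_def A_def B_def)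
  have iso_eq: "module_isomorphic R (sub_module_of_ring R T) (sub_module_of_ring Q B) \<longleftrightarrow>
      module_isomorphic R (sub_module_of_ring Q T) (sub_module_of_ring Q B)"
    by (simp add: module_isomorphic_def sub_module_simps
        F.module_hom_restrict_scalars(1)[OF T_A[unfolded A_def]])
  have i_iii: "D = B" if "T = colon Q A B"
    by (rule trace_square) (use scalar_closedD(4)[OF S.conductor_closed] that in blast)
  have i_ii: "module_isomorphic R (sub_module_of_ring Q T) (sub_module_of_ring Q B)"
    if T: "T = colon Q A B"
  proof -
    obtain c where c: "c \<in> Units Q" "T = {c \<otimes>\<^bsub>Q\<^esub> b | b. b \<in> B}"
      using S.conductor_principal unfolding T by blast
    have cc: "c \<in> carrier Q" using c(1) by (rule Q.Units_closed)
    have inv_c: "inv\<^bsub>Q\<^esub> c \<otimes>\<^bsub>Q\<^esub> (c \<otimes>\<^bsub>Q\<^esub> b) = b" if "b \<in> B" for b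
      using c(1) cc that BQ by (simp add: Q.m_assoc[symmetric] subset_iff)
    have "inv\<^bsub>Q\<^esub> c \<in> colon Q B T" using c(1) inv_c unfolding c(2) by (auto simp: colon_def)
    then have "(\<lambda>x. inv\<^bsub>Q\<^esub> c \<otimes>\<^bsub>Q\<^esub> x) \<in> module_hom R (sub_module_of_ring Q T) (sub_module_of_ring Q B)"
      by (rule F.colon_hom[OF scalar_closedD(1)[OF T_closed]])
    moreover have "bij_betw (\<lambda>x. inv\<^bsub>Q\<^esub> c \<otimes>\<^bsub>Q\<^esub> x) T B"
      by (rule bij_betwI[of _ _ _ "\<lambda>b. c \<otimes>\<^bsub>Q\<^esub> b"]) (use inv_c in \<open>auto simp: c(2)\<close>)
    ultimately show ?thesis unfolding module_isomorphic_def sub_module_simps by blast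
  qed
  have ii_iii: "D = B"
    if iso: "module_isomorphic R (sub_module_of_ring Q T) (sub_module_of_ring Q B)"
  proof (rule trace_square)
    obtain f where f: "f \<in> module_hom R (sub_module_of_ring Q T) (sub_module_of_ring Q B)"
      "bij_betw f T B"
      using iso unfolding module_isomorphic_def sub_module_simps by blast
    \<comment> \<open>The inverse isomorphism \<open>g\<close> starts at \<open>B\<close>, which
      contains one, so it is multiplication by \<open>g \<one>\<close>. Its image \<open>T\<close>
      therefore inherits closure under \<open>B\<close>.\<close>
    define g where "g = inv_into T f"
    have g: "g \<in> module_hom R (sub_module_of_ring Q B) (sub_module_of_ring Q T)"
      unfolding g_def
      using module_iso_sym[OF F.sub_module_module f(1)] T_closed f(2)
      by (simp add: sub_module_simps A_def)
    have TQ: "T \<subseteq> carrier Q" using scalar_closedD(1)[OF T_closed] .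
    have lin: "g b = b \<otimes>\<^bsub>Q\<^esub> g \<one>\<^bsub>Q\<^esub>" if "b \<in> B" for b
      using F.linear_is_multiplication[OF g _ sB(3) TQ that] B_closed by (simp add: A_def)
    have gT: "g b \<in> T" if "b \<in> B" for b
      using module_homD(1)[OF g] that by (simp add: sub_module_simps)
    fix b x assume bx: "b \<in> B" "x \<in> T"
    define y where "y = f x"
    have y: "y \<in> B" "x = g y"
      using f(2) bx(2) by (auto simp: y_def g_def bij_betw_def)
    have "g (b \<otimes>\<^bsub>Q\<^esub> y) = (b \<otimes>\<^bsub>Q\<^esub> y) \<otimes>\<^bsub>Q\<^esub> g \<one>\<^bsub>Q\<^esub>" using lin sB(6) bx(1) y(1) by blast
    also have "\<dots> = b \<otimes>\<^bsub>Q\<^esub> x"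
      using lin[OF y(1)] y bx gT[OF sB(3)] BQ TQ by (simp add: Q.m_assoc subset_iff)
    finally show "b \<otimes>\<^bsub>Q\<^esub> x \<in> T" using gT sB(6) bx(1) y(1) by metis
  qed
  \<comment> \<open>The three implications form a cycle: (i) to (ii), (ii) to (iii), and (iii) to
    (i).\<close>
  show ?thesis
    unfolding T_def[symmetric] B_def[symmetric] D_def[symmetric] i iso_eq
    using i_ii ii_iii square_trace by blast
qed

end
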